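(* Let $M<N$ and $1\le k\le N$ be positive integers. For each pair partition $\mathfrak{m}\in\mathcal{P}_k$, \begin{align*} \mathrm{Wg}^{\mathbf{A}}(\mathfrak{m})={}&-\frac1N\sum_{i=1}^{2k-2}\mathrm{Wg}^{\mathbf{A}}((i~2k-1)\cdot\mathfrak{m})+\frac MN\,\delta_{\{2k-1,2k\}\in\mathfrak{m}}\,\mathrm{Wg}^{\mathbf{A}}(\mathfrak{m}^\downarrow)\\ &+\frac1N\sum_{i=1}^{2k-2}\delta_{\{i,2k\}\in\mathfrak{m}}\,\mathrm{Wg}^{\mathbf{A}}([(i~2k-1)\cdot\mathfrak{m}]^\downarrow), \end{align*} where $\delta_{\{i,j\}\in\mathfrak{m}}$ is $1$ if $\{i,j\}\in\mathfrak{m}$ and $0$ otherwise.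
   Context: $\mathbf{A}(M,N)$ is the space of $N\times N$ real symmetric idempotent matrices of rank $M$, i.e. $\{OI_{M,N}O^T:O\in\mathrm{O}(N)\}$ with $I_{M,N}=\mathrm{diag}(1,\ldots,1,0,\ldots,0)$ ($M$ ones), with the Haar probability measure $\mathrm{d}\mu$ induced from $\mathrm{O}(N)$; $A_{ij}$ is the $(i,j)$ entry. $\mathcal{P}_k$ is the set of pair partitions of $\{1,\ldots,2k\}$ (partitions into two-element blocks), $\mathcal{P}_0=\{(~)\}$ the empty pair partition. The symmetric group $S_{2k}$ acts on $\mathcal{P}_k$ by $\{a,b\}\in\mathfrak{m}\iff\{\sigma(a),\sigma(b)\}\in\sigma\cdot\mathfrak{m}$. If $\{2k-1,2k\}\in\mathfrak{m}$, $\mathfrak{m}^\downarrow\in\mathcal{P}_{k-1}$ is obtained by deleting this block. A function $i:\{1,\ldots,2k\}\to\{1,\ldots,N\}$ is strongly admissible for $\mathfrak{m}$ if for all $a\neq b$, $\{a,b\}\in\mathfrak{m}\iff i(a)=i(b)$. The Weingarten function is $\mathrm{Wg}^{\mathbf{A}}(\mathfrak{m})=\int_{\mathbf{A}(M,N)}A_{i(1)i(2)}\cdots A_{i(2k-1)i(2k)}\,\mathrm{d}\mu$ for any strongly admissible $i$ (independent of the choice), and $\mathrm{Wg}^{\mathbf{A}}((~))=1$. *)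

theory Defs
  imports "HOL-Probability.Probability"
begin

definition orth_group :: "(real^'n^'n) set" where
  "orth_group = {Q. orthogonal_matrix Q}"

definition haar_O :: "(real^'n^'n) measure" where
  "haar_O = (THE mu. sets mu = sets (restrict_space borel orth_group)
                   \<and> space mu = orth_group
                   \<and> prob_space mu
                   \<and> (\<forall>U\<in>orth_group. distr mu mu (\<lambda>Q. U ** Q) = mu))"

definition I_MN :: "nat \<Rightarrow> ((real, 'n::{finite,linorder}) vec, 'n::{finite,linorder}) vec" where
  "I_MN M = (\<chi> r c. if r = c \<and> card {j. j < r} < M then 1 else 0)"

definition haar_A :: "nat \<Rightarrow> (((real, 'n::{finite,linorder}) vec, 'n::{finite,linorder}) vec) measure" where
  "haar_A M = distr haar_O borel (\<lambda>Q. Q ** I_MN M ** transpose Q)"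

definition pair_partitions :: "nat \<Rightarrow> nat set set set" where
  "pair_partitions k = {m. (\<forall>b\<in>m. card b = 2) \<and> \<Union>m = {1..2*k}
        \<and> (\<forall>b\<in>m. \<forall>b'\<in>m. b \<noteq> b' \<longrightarrow> b \<inter> b' = {})}"

definition perm_act :: "(nat \<Rightarrow> nat) \<Rightarrow> nat set set \<Rightarrow> nat set set" where
  "perm_act \<sigma> m = (\<lambda>b. \<sigma> ` b) ` m"

definition transp_ab :: "nat \<Rightarrow> nat \<Rightarrow> nat \<Rightarrow> nat" where
  "transp_ab a b = (\<lambda>x. if x = a then b else if x = b then a else x)"

definition down :: "nat \<Rightarrow> nat set set \<Rightarrow> nat set set" where
  "down k m = m - {{2*k-1, 2*k}}"

definition strongly_admissible :: "nat \<Rightarrow> nat set set \<Rightarrow> (nat \<Rightarrow> 'n) \<Rightarrow> bool" where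
  "strongly_admissible k m i \<longleftrightarrow>
     (\<forall>a\<in>{1..2*k}. \<forall>b\<in>{1..2*k}. a \<noteq> b \<longrightarrow> ({a,b} \<in> m \<longleftrightarrow> i a = i b))"

definition WgA :: "'n::{finite,linorder} itself \<Rightarrow> nat \<Rightarrow> nat \<Rightarrow> nat set set \<Rightarrow> real" where
  "WgA _ M k m = (if k = 0 then 1 else
     (let i = (SOME i :: nat \<Rightarrow> 'n. strongly_admissible k m i) in
       integral\<^sup>L (haar_A M :: ((real, 'n) vec, 'n) vec measure)
         (\<lambda>A. \<Prod>j<k. A $ i (2*j+1) $ i (2*j+2))))"

end

theory Submission
  imports Defs
begin

text \<open>
  Since the law of \<open>A\<close> is invariant under conjugation by \<open>O(N)\<close>, every moment
  \<open>E[\<Prod> A\<^bsub>i(2j+1) i(2j+2)\<^esub>]\<close> is unchanged when all index vectors are rotated by an angle \<open>\<theta>\<close> in a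
  coordinate plane \<open>(u, v)\<close>. The derivative at \<open>\<theta> = 0\<close> is a linear relation: replacing one index
  \<open>u\<close> by \<open>v\<close>, in all possible ways, gives the same total as replacing one \<open>v\<close> by \<open>u\<close>.

  Let \<open>i\<close> be strongly admissible for \<open>m\<close> and \<open>{2k-1, b}\<close> the block of \<open>2k-1\<close>. Setting both indices
  of this block to a value \<open>v\<close>, the relation expresses the resulting moment as \<open>Wg(m)\<close> plus the
  terms \<open>Wg((x 2k-1) m)\<close> for the positions \<open>x\<close> carrying the index \<open>v\<close>. Summed over \<open>v\<close>, this
  is \<open>N Wg(m)\<close> plus the sum over all \<open>x\<close>; but the sum over \<open>v\<close> also collapses to a moment of order
  \<open>k - 1\<close>, by \<open>tr A = M\<close> if \<open>b = 2k\<close> and by \<open>A\<^sup>2 = A\<close> otherwise.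

  The Haar measure on \<open>O(N)\<close> is defined by a definite description, so its existence (Gram-Schmidt
  applied to a rotation-invariant random matrix) and uniqueness (Fubini) are needed.
\<close>

section \<open>The orthogonal group and uniqueness of its Haar measure\<close>

lemma orth_group_mult: "U \<in> orth_group \<Longrightarrow> Q \<in> orth_group \<Longrightarrow> U ** Q \<in> orth_group"
  by (simp add: orth_group_def orthogonal_matrix_mul)

lemma orth_group_transpose: "Q \<in> orth_group \<Longrightarrow> transpose Q \<in> orth_group"
  by (simp add: orth_group_def)

lemma continuous_on_matrix_mult [continuous_intros]:
  fixes f :: "'a::topological_space \<Rightarrow> real^'n^'m" and g :: "'a \<Rightarrow> real^'p^'n"
  assumes "continuous_on S f" "continuous_on S g"
  shows "continuous_on S (\<lambda>x. f x ** g x)"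
  unfolding matrix_matrix_mult_def
  by (intro continuous_intros assms)

lemma continuous_on_transpose [continuous_intros]:
  fixes f :: "'a::topological_space \<Rightarrow> real^'n^'m"
  assumes "continuous_on S f"
  shows "continuous_on S (\<lambda>x. transpose (f x))"
  unfolding transpose_def
  by (intro continuous_intros assms)

lemma borel_measurable_matrix_mult [measurable (raw)]:
  fixes f :: "'a \<Rightarrow> real^'n^'m" and g :: "'a \<Rightarrow> real^'p^'n"
  assumes "f \<in> borel_measurable M" "g \<in> borel_measurable M"
  shows "(\<lambda>x. f x ** g x) \<in> borel_measurable M"
  by (rule borel_measurable_continuous_Pair[OF assms]) (intro continuous_intros)

lemma borel_measurable_transpose [measurable (raw)]:
  fixes f :: "'a \<Rightarrow> real^'n^'m"
  assumes "f \<in> borel_measurable M"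
  shows "(\<lambda>x. transpose (f x)) \<in> borel_measurable M"
  by (rule borel_measurable_continuous_on[OF _ assms]) (intro continuous_intros)

lemma closed_orth_group: "closed (orth_group :: (real^'n^'n) set)"
proof -
  have "(orth_group :: (real^'n^'n) set) = {Q. transpose Q ** Q = mat 1}"
    by (auto simp: orth_group_def orthogonal_matrix)
  moreover have "closed {Q :: real^'n^'n. transpose Q ** Q = mat 1}"
    by (intro closed_Collect_eq continuous_intros)
  ultimately show ?thesis by simp
qed

lemma compact_orth_group: "compact (orth_group :: (real^'n^'n) set)"
proof -
  have "norm Q \<le> real CARD('n)" if "Q \<in> orth_group" for Q :: "real^'n^'n"
  proof -
    have "norm Q \<le> (\<Sum>i\<in>UNIV. norm (Q $ i))"
      unfolding norm_vec_def by (rule L2_set_le_sum) simp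
    also have "\<dots> = (\<Sum>i\<in>(UNIV::'n set). 1)"
      using that by (intro sum.cong)
        (auto simp: orth_group_def orthogonal_matrix_orthonormal_rows row_def)
    finally show ?thesis by simp
  qed
  then have "bounded (orth_group :: (real^'n^'n) set)"
    by (auto simp: bounded_iff)
  with closed_orth_group show ?thesis
    by (simp add: compact_eq_bounded_closed)
qed

lemma nn_integral_distr_invariant:
  assumes "f \<in> measurable M N" "distr M N f = M" "h \<in> borel_measurable M"
  shows "(\<integral>\<^sup>+x. h (f x) \<partial>M) = (\<integral>\<^sup>+x. h x \<partial>M)"
  using nn_integral_distr[OF assms(1), of h] assms(2,3) by simp

definition left_haar :: "(real^'n^'n) measure \<Rightarrow> bool" where
  "left_haar mu \<longleftrightarrow> sets mu = sets (restrict_space borel orth_group)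
     \<and> space mu = orth_group \<and> prob_space mu
     \<and> (\<forall>U\<in>orth_group. distr mu mu (\<lambda>Q. U ** Q) = mu)"

lemma left_haarD:
  assumes "left_haar mu"
  shows "sets mu = sets (restrict_space borel orth_group)"
    and "space mu = orth_group"
    and "prob_space mu"
    and "U \<in> orth_group \<Longrightarrow> distr mu mu (\<lambda>Q. U ** Q) = mu"
  using assms by (simp_all add: left_haar_def)

lemma measurable_from_left_haar:
  assumes "left_haar mu" "f \<in> measurable borel N"
  shows "f \<in> measurable mu N"
  unfolding measurable_cong_sets[OF left_haarD(1)[OF assms(1)] refl]
  using assms(2) by (rule measurable_restrict_space1)

lemma measurable_mult_left_haar:
  assumes "left_haar mu" "U \<in> orth_group"
  shows "(\<lambda>Q. U ** Q) \<in> measurable mu mu"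
proof -
  have "(\<lambda>Q. U ** Q) \<in> borel_measurable mu"
    using assms(1) by (rule measurable_from_left_haar) measurable
  then show ?thesis
    unfolding measurable_cong_sets[OF refl left_haarD(1)[OF assms(1)]]
    using assms by (intro measurable_restrict_space2) (auto simp: left_haarD(2) orth_group_mult)
qed

lemma nn_integral_left_haar_mult:
  assumes "left_haar mu" "U \<in> orth_group" "f \<in> borel_measurable borel"
  shows "(\<integral>\<^sup>+x. f (U ** x) \<partial>mu) = (\<integral>\<^sup>+x. f x \<partial>mu)"
  by (rule nn_integral_distr_invariant[OF measurable_mult_left_haar[OF assms(1,2)]
        left_haarD(4)[OF assms(1,2)] measurable_from_left_haar[OF assms(1,3)]])

text \<open>Integrate \<open>f (y\<^sup>T x)\<close> over both variables: invariance of \<open>mu\<close> in \<open>x\<close> gives the left-hand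
  side, invariance of \<open>nu\<close> in \<open>y\<close> the right-hand side.\<close>

lemma nn_integral_left_haar_transpose:
  assumes mu: "left_haar mu" and nu: "left_haar nu" and f: "f \<in> borel_measurable borel"
  shows "(\<integral>\<^sup>+x. f x \<partial>mu) = (\<integral>\<^sup>+y. f (transpose y) \<partial>nu)"
proof -
  interpret mu: prob_space mu by (rule left_haarD(3)[OF mu])
  interpret nu: prob_space nu by (rule left_haarD(3)[OF nu])
  interpret pair_sigma_finite nu mu ..
  have "fst \<in> borel_measurable (nu \<Otimes>\<^sub>M mu)" "snd \<in> borel_measurable (nu \<Otimes>\<^sub>M mu)"
    using measurable_compose[OF measurable_fst measurable_from_left_haar[OF nu measurable_ident]]
      measurable_compose[OF measurable_snd measurable_from_left_haar[OF mu measurable_ident]]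
    by simp_all
  then have "(\<lambda>p. transpose (fst p) ** snd p) \<in> borel_measurable (nu \<Otimes>\<^sub>M mu)"
    by (intro borel_measurable_matrix_mult borel_measurable_transpose)
  then have f_meas: "(\<lambda>p. f (transpose (fst p) ** snd p)) \<in> borel_measurable (nu \<Otimes>\<^sub>M mu)"
    using f by (rule measurable_compose)
  have "(\<integral>\<^sup>+x. f x \<partial>mu) = (\<integral>\<^sup>+y. \<integral>\<^sup>+x. f x \<partial>mu \<partial>nu)"
    by (simp add: nu.emeasure_space_1)
  also have "\<dots> = (\<integral>\<^sup>+y. \<integral>\<^sup>+x. f (transpose y ** x) \<partial>mu \<partial>nu)"
    using nn_integral_left_haar_mult[OF mu orth_group_transpose f]
    by (simp cong: nn_integral_cong_simp add: left_haarD(2)[OF nu])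
  also have "\<dots> = (\<integral>\<^sup>+x. \<integral>\<^sup>+y. f (transpose y ** x) \<partial>nu \<partial>mu)"
    using Fubini[OF f_meas] by simp
  also have "\<dots> = (\<integral>\<^sup>+x. \<integral>\<^sup>+y. f (transpose (transpose x ** y)) \<partial>nu \<partial>mu)"
    by (simp add: matrix_transpose_mul)
  also have "\<dots> = (\<integral>\<^sup>+x. \<integral>\<^sup>+y. f (transpose y) \<partial>nu \<partial>mu)"
    using nn_integral_left_haar_mult[OF nu orth_group_transpose, of _ "\<lambda>y. f (transpose y)"]
      measurable_compose[OF borel_measurable_transpose[OF measurable_ident] f]
    by (simp cong: nn_integral_cong_simp add: left_haarD(2)[OF mu])
  finally show ?thesis
    by (simp add: mu.emeasure_space_1)
qed

lemma left_haar_unique: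
  assumes mu: "left_haar mu" and nu: "left_haar nu"
  shows "mu = nu"
proof (rule measure_eqI)
  show sets_eq: "sets mu = sets nu"
    by (simp add: left_haarD(1) mu nu)
  fix A assume A: "A \<in> sets mu"
  then have "A \<in> sets borel"
    by (simp add: left_haarD(1)[OF mu] sets_restrict_space_iff borel_closed[OF closed_orth_group])
  then have indicator: "(indicator A :: _ \<Rightarrow> ennreal) \<in> borel_measurable borel"
    by simp
  have "(\<integral>\<^sup>+x. indicator A x \<partial>mu) = (\<integral>\<^sup>+x. indicator A x \<partial>nu)"
    using nn_integral_left_haar_transpose[OF mu nu indicator]
      nn_integral_left_haar_transpose[OF nu nu indicator] by simp
  then show "emeasure mu A = emeasure nu A"
    using A sets_eq by simp
qed

section \<open>Existence of the Haar measure\<close>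

lemma emeasure_lborel_open_nonzero:
  fixes S :: "'a::euclidean_space set"
  assumes "open S" "S \<noteq> {}"
  shows "emeasure lborel S \<noteq> 0"
proof
  assume "emeasure lborel S = 0"
  then have "S \<in> null_sets (completion lborel)"
    using assms(1) by (intro null_sets_completionI) auto
  then show False
    using open_not_negligible[OF assms] by (simp add: negligible_iff_null_sets)
qed

lemma prob_space_uniform_measure_lborel:
  fixes S :: "'a::euclidean_space set"
  assumes "open S" "S \<noteq> {}" "bounded S"
  shows "prob_space (uniform_measure lborel S)"
  using emeasure_lborel_open_nonzero[OF assms(1,2)] emeasure_bounded_finite[OF assms(3)]
  by (intro prob_space_uniform_measure) auto

lemma nn_integral_translation_invariant:
  fixes mu :: "'a::euclidean_space measure" and h :: "'a \<Rightarrow> ennreal"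
  assumes "sets mu = sets borel" "\<And>c. distr mu borel ((+) c) = mu" "h \<in> borel_measurable borel"
  shows "(\<integral>\<^sup>+x. h (c + x) \<partial>mu) = (\<integral>\<^sup>+x. h x \<partial>mu)"
  using assms
  by (intro nn_integral_distr_invariant[where N = borel]) (auto cong: measurable_cong_sets)

text \<open>Integrate the indicator of \<open>x \<in> A \<and> y - x \<in> B\<close> over both variables, in the two orders.\<close>

lemma emeasure_translation_invariant_mult:
  fixes mu nu :: "'a::euclidean_space measure"
  assumes sigma_finite: "sigma_finite_measure mu" "sigma_finite_measure nu"
    and sets: "sets mu = sets borel" "sets nu = sets borel"
    and shift_mu: "\<And>c. distr mu borel ((+) c) = mu"
    and shift_nu: "\<And>c. distr nu borel ((+) c) = nu"
    and A: "A \<in> sets borel" and B: "B \<in> sets borel"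
  shows "emeasure mu A * emeasure nu B = emeasure nu A * emeasure mu (uminus -` B)"
proof -
  interpret mu: sigma_finite_measure mu by fact
  interpret nu: sigma_finite_measure nu by fact
  interpret pair_sigma_finite mu nu ..
  note [measurable_cong] = sets
  note [measurable] = A B
  note shift = nn_integral_translation_invariant[OF sets(1) shift_mu]
    nn_integral_translation_invariant[OF sets(2) shift_nu]
  have vimage_B: "uminus -` B \<in> sets borel"
    using measurable_sets[OF borel_measurable_uminus[OF measurable_ident] B] by simp
  have "emeasure mu A * emeasure nu B = (\<integral>\<^sup>+x. indicator A x * (\<integral>\<^sup>+y. indicator B y \<partial>nu) \<partial>mu)"
    by (simp add: nn_integral_multc sets A B)
  also have "\<dots> = (\<integral>\<^sup>+x. indicator A x * (\<integral>\<^sup>+y. indicator B (- x + y) \<partial>nu) \<partial>mu)"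
    by (subst shift(2)) simp_all
  also have "\<dots> = (\<integral>\<^sup>+x. \<integral>\<^sup>+y. indicator A x * indicator B (- x + y) \<partial>nu \<partial>mu)"
    by (simp add: nn_integral_cmult)
  also have "\<dots> = (\<integral>\<^sup>+y. \<integral>\<^sup>+x. indicator A x * indicator B (- x + y) \<partial>mu \<partial>nu)"
    using Fubini[of "\<lambda>p. indicator A (fst p) * indicator B (- fst p + snd p)"] by simp
  also have "\<dots> = (\<integral>\<^sup>+y. \<integral>\<^sup>+x. indicator A (y + x) * indicator B (- x) \<partial>mu \<partial>nu)"
  proof (rule nn_integral_cong)
    show "(\<integral>\<^sup>+x. indicator A x * indicator B (- x + y) \<partial>mu)
        = (\<integral>\<^sup>+x. indicator A (y + x) * indicator B (- x) \<partial>mu)" for y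
      using shift(1)[of "\<lambda>x. indicator A x * indicator B (- x + y)" y] by simp
  qed
  also have "\<dots> = (\<integral>\<^sup>+x. \<integral>\<^sup>+y. indicator A (y + x) * indicator B (- x) \<partial>nu \<partial>mu)"
    using Fubini[of "\<lambda>p. indicator A (snd p + fst p) * indicator B (- fst p)"] by simp
  also have "\<dots> = (\<integral>\<^sup>+x. (\<integral>\<^sup>+y. indicator A (x + y) \<partial>nu) * indicator (uminus -` B) x \<partial>mu)"
    by (simp add: nn_integral_multc add.commute indicator_def)
  also have "\<dots> = emeasure nu A * emeasure mu (uminus -` B)"
    by (subst shift(2)) (simp_all add: nn_integral_cmult sets A vimage_B)
  finally show ?thesis .
qed

lemma translation_invariant_eq_lborel:
  fixes mu :: "'a::euclidean_space measure"
  assumes sigma_finite: "sigma_finite_measure mu" and sets: "sets mu = sets borel"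
    and shift: "\<And>c. distr mu borel ((+) c) = mu"
    and ball: "emeasure mu (ball 0 1) = emeasure lborel (ball (0::'a) 1)"
  shows "mu = lborel"
proof (rule measure_eqI)
  let ?B = "ball (0::'a) 1"
  fix A assume "A \<in> sets mu"
  then have "emeasure mu A * emeasure lborel ?B = emeasure lborel A * emeasure mu (uminus -` ?B)"
    using sets lborel_distr_plus
    by (intro emeasure_translation_invariant_mult sigma_finite sigma_finite_lborel shift) auto
  also have "uminus -` ?B = ?B" by auto
  finally have "emeasure mu A * emeasure lborel ?B = emeasure lborel A * emeasure lborel ?B"
    by (simp only: ball)
  moreover have "emeasure lborel ?B \<noteq> 0" "emeasure lborel ?B \<noteq> \<infinity>"
    using emeasure_lborel_open_nonzero[of ?B] emeasure_lborel_ball_finite[of "0::'a" 1] by auto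
  ultimately show "emeasure mu A = emeasure lborel A"
    by (metis ennreal_mult_divide_eq infinity_ennreal_def)
qed (simp add: sets)

lemma borel_measurable_orthogonal_transformation:
  fixes f :: "'a::euclidean_space \<Rightarrow> 'a"
  assumes "orthogonal_transformation f"
  shows "f \<in> borel_measurable borel"
  using assms by (intro borel_measurable_continuous_onI linear_continuous_on)
    (simp add: orthogonal_transformation_linear linear_conv_bounded_linear[symmetric])

lemma distr_lborel_orthogonal_transformation:
  fixes f :: "'a::euclidean_space \<Rightarrow> 'a"
  assumes f: "orthogonal_transformation f"
  shows "distr lborel borel f = lborel"
proof (rule translation_invariant_eq_lborel)
  obtain g where g: "orthogonal_transformation g" "\<And>x. f (g x) = x" "\<And>x. g (f x) = x"
    using f orthogonal_transformation_bij[OF f] orthogonal_transformation_inv[OF f]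
    by (metis bij_inv_eq_iff)
  note [measurable] = f[THEN borel_measurable_orthogonal_transformation]
    g(1)[THEN borel_measurable_orthogonal_transformation]
  show "sigma_finite_measure (distr lborel borel f)"
  proof (rule sigma_finite_measure_distr)
    have "distr (distr lborel borel f) borel g = lborel"
      by (simp add: distr_distr comp_def g distr_id2)
    then show "sigma_finite_measure (distr (distr lborel borel f) borel g)"
      by (simp add: sigma_finite_lborel)
  qed simp
  show "distr (distr lborel borel f) borel ((+) c) = distr lborel borel f" for c
  proof -
    have "distr (distr lborel borel f) borel ((+) c) = distr lborel borel (f \<circ> (+) (g c))"
      using f by (simp add: distr_distr comp_def g linear_add[OF orthogonal_transformation_linear])
    also have "\<dots> = distr lborel borel f"
      by (subst (2) lborel_distr_plus[of "g c", symmetric]) (simp add: distr_distr)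
    finally show ?thesis .
  qed
  have "f -` ball 0 1 = ball 0 1"
    by (auto simp: orthogonal_transformation_norm[OF f])
  then show "emeasure (distr lborel borel f) (ball 0 1) = emeasure lborel (ball (0::'a) 1)"
    by (simp add: emeasure_distr)
qed simp

lemma distr_uniform_measure_invariant:
  assumes f: "f \<in> measurable M N" "distr M N f = M"
    and S: "S \<in> sets M" "f -` S \<inter> space M = S"
  shows "distr (uniform_measure M S) N f = uniform_measure M S"
proof (rule measure_eqI)
  have sets: "sets N = sets M" using f(2) by (metis sets_distr)
  then show "sets (distr (uniform_measure M S) N f) = sets (uniform_measure M S)" by simp
  fix A assume "A \<in> sets (distr (uniform_measure M S) N f)"
  then have A: "A \<in> sets N" by simp
  have vimage: "f -` A \<inter> space M \<in> sets M" using f(1) A by (rule measurable_sets)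
  have "emeasure (distr (uniform_measure M S) N f) A
      = emeasure M (S \<inter> (f -` A \<inter> space M)) / emeasure M S"
    using f(1) A S(1) vimage by (simp add: emeasure_distr)
  also have "S \<inter> (f -` A \<inter> space M) = f -` (S \<inter> A) \<inter> space M"
    using S(2) by auto
  also have "emeasure M (f -` (S \<inter> A) \<inter> space M) = emeasure M (S \<inter> A)"
    using emeasure_distr[OF f(1), of "S \<inter> A"] f(2) S(1) A sets by simp
  finally show "emeasure (distr (uniform_measure M S) N f) A = emeasure (uniform_measure M S) A"
    using S(1) A sets by simp
qed

fun gram_schmidt :: "(nat \<Rightarrow> 'a::real_inner) \<Rightarrow> nat \<Rightarrow> 'a" where
  "gram_schmidt x k = sgn (x k - (\<Sum>l<k. (x k \<bullet> gram_schmidt x l) *\<^sub>R gram_schmidt x l))"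

declare gram_schmidt.simps [simp del]

lemma gram_schmidt_in_span: "gram_schmidt x k \<in> span (x ` {..k})"
proof (induction k rule: less_induct)
  case (less k)
  have "gram_schmidt x l \<in> span (x ` {..k})" if "l < k" for l
    using less[OF that] span_mono[of "x ` {..l}" "x ` {..k}"] that by force
  then have "x k - (\<Sum>l<k. (x k \<bullet> gram_schmidt x l) *\<^sub>R gram_schmidt x l) \<in> span (x ` {..k})"
    by (intro span_diff span_sum span_mul) (auto intro: span_base)
  then show ?case
    by (subst gram_schmidt.simps) (simp only: sgn_div_norm span_mul)
qed

lemma gram_schmidt_orthonormal:
  assumes "\<And>j. j < n \<Longrightarrow> x j \<notin> span (x ` {..<j})" "i < n" "j < n"
  shows "gram_schmidt x i \<bullet> gram_schmidt x j = (if i = j then 1 else 0)"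
  using assms
proof (induction n arbitrary: i j)
  case (Suc n)
  let ?g = "gram_schmidt x"
  define r where "r = x n - (\<Sum>l<n. (x n \<bullet> ?g l) *\<^sub>R ?g l)"
  have g_n: "?g n = sgn r" unfolding r_def by (rule gram_schmidt.simps)
  have IH: "?g l \<bullet> ?g l' = (if l = l' then 1 else 0)" if "l < n" "l' < n" for l l'
    using Suc.IH Suc.prems(1) that by simp
  have "?g l \<in> span (x ` {..<n})" if "l < n" for l
    using gram_schmidt_in_span[of x l] span_mono[of "x ` {..l}" "x ` {..<n}"] that by force
  then have "(\<Sum>l<n. (x n \<bullet> ?g l) *\<^sub>R ?g l) \<in> span (x ` {..<n})"
    by (intro span_sum span_mul) auto
  then have "r \<noteq> 0" using Suc.prems(1)[of n] by (auto simp: r_def)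
  then have unit: "?g n \<bullet> ?g n = 1"
    by (simp add: g_n norm_eq_1[symmetric] norm_sgn)
  have "?g n \<bullet> ?g l = 0" if "l < n" for l
  proof -
    have "r \<bullet> ?g l = x n \<bullet> ?g l - (\<Sum>l'<n. if l' = l then x n \<bullet> ?g l' else 0)"
      using that by (simp add: r_def inner_diff_left inner_sum_left IH if_distrib cong: if_cong)
    also have "\<dots> = 0" using that by simp
    finally show ?thesis by (simp add: g_n sgn_div_norm)
  qed
  with unit show ?case
    using Suc.prems(2,3) IH by (auto simp: less_Suc_eq inner_commute)
qed simp

lemma gram_schmidt_orthogonal_transformation:
  assumes f: "orthogonal_transformation f"
  shows "gram_schmidt (\<lambda>k. f (x k)) k = f (gram_schmidt x k)"
proof (induction k rule: less_induct)
  case (less k)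
  let ?g = "gram_schmidt x"
  have lin: "linear f" using f by (rule orthogonal_transformation_linear)
  have "(\<Sum>l<k. (f (x k) \<bullet> gram_schmidt (\<lambda>k. f (x k)) l) *\<^sub>R gram_schmidt (\<lambda>k. f (x k)) l)
      = (\<Sum>l<k. f ((x k \<bullet> ?g l) *\<^sub>R ?g l))"
    using f by (intro sum.cong) (auto simp: less orthogonal_transformation_def linear_cmul)
  then have "f (x k)
        - (\<Sum>l<k. (f (x k) \<bullet> gram_schmidt (\<lambda>k. f (x k)) l) *\<^sub>R gram_schmidt (\<lambda>k. f (x k)) l)
      = f (x k - (\<Sum>l<k. (x k \<bullet> ?g l) *\<^sub>R ?g l))"
    by (simp only: linear_diff[OF lin] linear_sum[OF lin])
  then show ?case
    by (subst (1 2) gram_schmidt.simps)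
      (simp only: sgn_div_norm linear_cmul[OF lin] orthogonal_transformation_norm[OF f])
qed

lemma borel_measurable_gram_schmidt:
  fixes x :: "'b \<Rightarrow> nat \<Rightarrow> 'a::euclidean_space"
  assumes [measurable]: "\<And>k. (\<lambda>w. x w k) \<in> borel_measurable M"
  shows "(\<lambda>w. gram_schmidt (x w) k) \<in> borel_measurable M"
proof (induction k rule: less_induct)
  case (less k)
  have [measurable]: "(\<lambda>w. \<Sum>l<k. (x w k \<bullet> gram_schmidt (x w) l) *\<^sub>R gram_schmidt (x w) l)
      \<in> borel_measurable M"
    by (intro borel_measurable_sum borel_measurable_scaleR borel_measurable_inner less) auto
  show ?case
    by (subst gram_schmidt.simps) (simp add: sgn_div_norm, measurable)
qed

lemma column_matrix_mult: "column c (A ** B) = A *v column c B"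
  by (simp add: vec_eq_iff column_def matrix_matrix_mult_def matrix_vector_mult_def)

lemma matrix_eq_columns: "X = Y \<longleftrightarrow> (\<forall>c. column c X = column c Y)"
  by (auto simp: column_def vec_eq_iff)

lemma inner_matrix_columns:
  fixes X Y :: "real^'n^'m"
  shows "X \<bullet> Y = (\<Sum>c\<in>UNIV. column c X \<bullet> column c Y)"
  unfolding inner_vec_def column_def by simp (rule sum.swap)

lemma orthogonal_transformation_matrix_vector_mult:
  assumes "U \<in> orth_group"
  shows "orthogonal_transformation (\<lambda>v. U *v v)"
  using assms by (simp add: orth_group_def orthogonal_transformation_matrix)

lemma orthogonal_transformation_matrix_mult:
  fixes U :: "real^'n^'n"
  assumes "U \<in> orth_group"
  shows "orthogonal_transformation (\<lambda>X::real^'m^'n. U ** X)"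
proof -
  have "linear (\<lambda>X::real^'m^'n. U ** X)"
    by (rule linearI)
      (simp_all add: vec_eq_iff matrix_matrix_mult_def sum_distrib_left algebra_simps sum.distrib)
  with orthogonal_transformation_matrix_vector_mult[OF assms] show ?thesis
    by (simp add: orthogonal_transformation_def inner_matrix_columns column_matrix_mult)
qed

lemma column_not_in_span:
  fixes X :: "real^'n^'n"
  assumes "det X \<noteq> 0"
  shows "column c X \<notin> span {column j X |j. j \<noteq> c}"
proof
  let ?A = "transpose X"
  assume "column c X \<in> span {column j X |j. j \<noteq> c}"
  then have "- row c ?A \<in> vec.span {row j ?A |j. j \<noteq> c}"
    by (auto simp: span_vec_eq intro: span_neg)
  from det_row_span[OF this]
  have "det ?A = det (\<chi> k. if k = c then 0 else row k ?A)" by (simp cong: if_cong)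
  also have "\<dots> = 0"
    by (rule det_zero_row(2)[of c]) (simp add: row_def vec_eq_iff)
  finally show False using assms by simp
qed

definition gram_schmidt_matrix :: "real^'n^'n \<Rightarrow> real^'n^'n" where
  "gram_schmidt_matrix X =
    (\<chi> r c. gram_schmidt (\<lambda>k. column (from_nat_into UNIV k) X) (to_nat_on UNIV c) $ r)"

lemma column_gram_schmidt_matrix:
  "column c (gram_schmidt_matrix X)
    = gram_schmidt (\<lambda>k. column (from_nat_into UNIV k) X) (to_nat_on UNIV c)"
  by (simp add: gram_schmidt_matrix_def column_def)

lemma gram_schmidt_matrix_mult:
  assumes "U \<in> orth_group"
  shows "gram_schmidt_matrix (U ** X) = U ** gram_schmidt_matrix X"
  using orthogonal_transformation_matrix_vector_mult[OF assms,
      THEN gram_schmidt_orthogonal_transformation]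
  by (simp add: matrix_eq_columns column_gram_schmidt_matrix column_matrix_mult)

lemma gram_schmidt_matrix_in_orth_group:
  fixes X :: "real^'n^'n"
  assumes det: "det X \<noteq> 0"
  shows "gram_schmidt_matrix X \<in> orth_group"
proof -
  let ?n = "CARD('n)"
  let ?f = "from_nat_into (UNIV :: 'n set)" and ?g = "to_nat_on (UNIV :: 'n set)"
  let ?x = "\<lambda>k. column (?f k) X"
  have g_less: "?g c < ?n" for c
    using bij_betwE[OF to_nat_on_finite[of "UNIV :: 'n set"]] by simp
  have g_eq: "?g a = ?g b \<longleftrightarrow> a = b" for a b
    by (simp add: countable_finite)
  have f_inj: "inj_on ?f {..<?n}"
    using bij_betw_from_nat_into_finite[of "UNIV :: 'n set"] by (simp add: bij_betw_def)
  have "?x j \<notin> span (?x ` {..<j})" if "j < ?n" for j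
  proof -
    have "?x ` {..<j} \<subseteq> {column i X |i. i \<noteq> ?f j}"
      using that inj_onD[OF f_inj, of _ j] by fastforce
    then show ?thesis
      using column_not_in_span[OF det, of "?f j"] span_mono by blast
  qed
  then have "column a (gram_schmidt_matrix X) \<bullet> column b (gram_schmidt_matrix X)
      = (if a = b then 1 else 0)" for a b
    unfolding column_gram_schmidt_matrix
    by (subst gram_schmidt_orthonormal[of ?n]) (simp_all add: g_less g_eq)
  then show ?thesis
    by (simp add: orth_group_def orthogonal_matrix_orthonormal_columns orthogonal_def norm_eq_1)
qed

lemma borel_measurable_vec_lambda:
  fixes f :: "'n::finite \<Rightarrow> 'a \<Rightarrow> 'b::euclidean_space"
  assumes "\<And>i. f i \<in> borel_measurable M"
  shows "(\<lambda>w. \<chi> i. f i w) \<in> borel_measurable M"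
  using assms
  by (subst borel_measurable_euclidean_space) (auto simp: Basis_vec_def inner_axis)

lemma borel_measurable_vec_nth [measurable (raw)]:
  fixes f :: "'a \<Rightarrow> ('b::topological_space, 'n::finite) vec"
  assumes "f \<in> borel_measurable M"
  shows "(\<lambda>w. f w $ i) \<in> borel_measurable M"
  using assms by (rule borel_measurable_continuous_on[rotated]) (intro continuous_intros)

lemma borel_measurable_gram_schmidt_matrix:
  "(gram_schmidt_matrix :: real^'n^'n \<Rightarrow> _) \<in> borel_measurable borel"
  unfolding gram_schmidt_matrix_def column_def
  by (intro borel_measurable_vec_lambda borel_measurable_vec_nth borel_measurable_gram_schmidt)
    measurable

lemma left_haar_distr:
  fixes nu :: "(real^'n^'n) measure"
  assumes nu: "prob_space nu" "sets nu = sets borel"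
    and nu_inv: "\<And>U. U \<in> orth_group \<Longrightarrow> distr nu borel (\<lambda>X. U ** X) = nu"
    and f: "f \<in> borel_measurable borel" "\<And>X. f X \<in> orth_group"
    and f_mult: "\<And>U. U \<in> orth_group \<Longrightarrow> AE X in nu. f (U ** X) = U ** f X"
  shows "left_haar (distr nu (restrict_space borel orth_group) f)"
proof -
  let ?R = "restrict_space borel (orth_group :: (real^'n^'n) set)"
  let ?mu = "distr nu ?R f"
  note [measurable_cong] = nu(2)
  have f_R: "f \<in> measurable borel ?R" and f_nu: "f \<in> measurable nu ?R"
    using f by (auto intro!: measurable_restrict_space2 cong: measurable_cong_sets)
  have "distr ?mu ?mu (\<lambda>Q. U ** Q) = ?mu" if U: "U \<in> orth_group" for U
  proof -
    have mult_R: "(\<lambda>Q. U ** Q) \<in> measurable ?R ?R"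
      using U by (intro measurable_restrict_space3) (auto simp: orth_group_mult)
    have mult_nu: "(\<lambda>Q. U ** Q) \<in> borel_measurable nu" by measurable
    have "distr ?mu ?mu (\<lambda>Q. U ** Q) = distr ?mu ?R (\<lambda>Q. U ** Q)"
      by (rule distr_cong) auto
    also have "\<dots> = distr nu ?R ((\<lambda>Q. U ** Q) \<circ> f)"
      by (rule distr_distr[OF mult_R f_nu])
    also have "\<dots> = distr nu ?R (f \<circ> (\<lambda>Q. U ** Q))"
      using f_mult[OF U] measurable_comp[OF f_nu mult_R] measurable_comp[OF mult_nu f_R]
      by (intro distr_cong_AE) (auto elim: eventually_mono)
    also have "\<dots> = distr (distr nu borel (\<lambda>Q. U ** Q)) ?R f"
      by (rule distr_distr[OF f_R mult_nu, symmetric])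
    finally show ?thesis by (simp add: nu_inv[OF U])
  qed
  then show ?thesis
    using prob_space.prob_space_distr[OF nu(1) f_nu]
    by (simp add: left_haar_def space_restrict_space)
qed

text \<open>Push the uniform distribution on a set of invertible matrices that is stable under \<open>O(N)\<close>
  forward along Gram-Schmidt.\<close>

lemma left_haar_exists: "\<exists>mu :: (real^'n^'n) measure. left_haar mu"
proof -
  let ?r = "norm (mat 1 :: real^'n^'n) + 1"
  define S where "S = {X :: real^'n^'n. norm X < ?r \<and> det X \<noteq> 0}"
  define f where "f X = (if X \<in> S then gram_schmidt_matrix X else mat 1)" for X :: "real^'n^'n"
  have "continuous_on UNIV (det :: real^'n^'n \<Rightarrow> real)"
    unfolding det_def by (intro continuous_intros)
  then have "open S"
    unfolding S_def
    by (intro open_Collect_conj open_Collect_less open_Collect_neq continuous_intros)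
  then have [measurable]: "S \<in> sets borel" by simp
  have S: "S \<noteq> {}" "bounded S"
    by (auto simp: S_def bounded_iff intro: less_imp_le exI[of _ "mat 1"] exI[of _ ?r])
  have mult_S: "U ** X \<in> S \<longleftrightarrow> X \<in> S" if "U \<in> orth_group" for U X :: "real^'n^'n"
    using that det_orthogonal_matrix[of U]
      orthogonal_transformation_matrix_mult[OF that, THEN orthogonal_transformation_norm, of X]
    by (auto simp: S_def det_mul orth_group_def)
  note [measurable] = borel_measurable_gram_schmidt_matrix
  have "left_haar (distr (uniform_measure lborel S) (restrict_space borel orth_group) f)"
  proof (rule left_haar_distr)
    show "prob_space (uniform_measure lborel S)"
      using \<open>open S\<close> S by (intro prob_space_uniform_measure_lborel)
    show "f \<in> borel_measurable borel"
      unfolding f_def by measurable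
    show "f X \<in> orth_group" for X
      using gram_schmidt_matrix_in_orth_group
      by (auto simp: f_def S_def orth_group_def orthogonal_matrix_id)
  next
    fix U :: "real^'n^'n" assume U: "U \<in> orth_group"
    show "distr (uniform_measure lborel S) borel (\<lambda>X. U ** X) = uniform_measure lborel S"
      using U
      by (intro distr_uniform_measure_invariant distr_lborel_orthogonal_transformation
          orthogonal_transformation_matrix_mult) (auto simp: mult_S)
    show "AE X in uniform_measure lborel S. f (U ** X) = U ** f X"
      by (rule AE_uniform_measureI) (auto simp: f_def mult_S[OF U] gram_schmidt_matrix_mult[OF U])
  qed simp
  then show ?thesis ..
qed

lemma left_haar_haar_O: "left_haar haar_O"
proof -
  have "haar_O = (THE mu. left_haar mu)"
    by (simp add: haar_O_def left_haar_def)
  then show ?thesis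
    using left_haar_exists left_haar_unique by (metis theI)
qed

section \<open>Random projections\<close>

text \<open>The notation \<open>real^'n\<close> pins \<open>'n\<close> to the class \<open>finite\<close> and cannot be combined with
  \<open>linorder\<close>.\<close>

type_synonym 'n rvec = "(real, 'n) vec"
type_synonym 'n sqmat = "((real, 'n) vec, 'n) vec"

lemma borel_measurable_conj_I_MN [measurable]:
  "(\<lambda>Q. Q ** I_MN M ** transpose Q) \<in> borel_measurable haar_O"
  by (rule measurable_from_left_haar[OF left_haar_haar_O]) measurable

lemma sets_haar_A [measurable_cong]: "sets (haar_A M) = sets borel"
  by (simp add: haar_A_def)

lemma prob_space_haar_A: "prob_space (haar_A M)"
  unfolding haar_A_def
  using left_haarD(3)[OF left_haar_haar_O] borel_measurable_conj_I_MN
  by (rule prob_space.prob_space_distr)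

lemma distr_haar_A_conj:
  assumes U: "U \<in> orth_group"
  shows "distr (haar_A M) borel (\<lambda>A. U ** A ** transpose U) = haar_A M"
proof -
  have "distr (haar_A M) borel (\<lambda>A. U ** A ** transpose U)
      = distr haar_O borel ((\<lambda>A. U ** A ** transpose U) \<circ> (\<lambda>Q. Q ** I_MN M ** transpose Q))"
    unfolding haar_A_def by (rule distr_distr) measurable
  also have "(\<lambda>A. U ** A ** transpose U) \<circ> (\<lambda>Q. Q ** I_MN M ** transpose Q)
      = (\<lambda>Q. Q ** I_MN M ** transpose Q) \<circ> (\<lambda>Q. U ** Q)"
    by (simp add: fun_eq_iff matrix_transpose_mul matrix_mul_assoc)
  also have "distr haar_O borel ((\<lambda>Q. Q ** I_MN M ** transpose Q) \<circ> (\<lambda>Q. U ** Q))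
      = distr (distr haar_O haar_O (\<lambda>Q. U ** Q)) borel (\<lambda>Q. Q ** I_MN M ** transpose Q)"
    using borel_measurable_conj_I_MN measurable_mult_left_haar[OF left_haar_haar_O U]
    by (rule distr_distr[symmetric])
  finally show ?thesis
    by (simp add: left_haarD(4)[OF left_haar_haar_O U] haar_A_def)
qed

lemma AE_haar_A:
  assumes "Measurable.pred borel P" "\<And>Q. Q \<in> orth_group \<Longrightarrow> P (Q ** I_MN M ** transpose Q)"
  shows "AE A in haar_A M. P A"
proof -
  have "{A \<in> space borel. P A} \<in> sets borel" using assms(1) by (rule predE)
  then show ?thesis
    unfolding haar_A_def using assms(2)
    by (subst AE_distr_iff[OF borel_measurable_conj_I_MN])
      (auto simp: left_haarD(2)[OF left_haar_haar_O])
qed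

lemma integrable_haar_A:
  fixes f :: "'n::{finite,linorder} sqmat \<Rightarrow> real"
  assumes f: "continuous_on UNIV f"
  shows "integrable (haar_A M) f"
proof -
  interpret prob_space "haar_A M :: ('n sqmat) measure" by (rule prob_space_haar_A)
  have [measurable]: "f \<in> borel_measurable borel"
    using f by (rule borel_measurable_continuous_onI)
  have "compact ((\<lambda>Q::'n sqmat. f (Q ** I_MN M ** transpose Q)) ` orth_group)"
    by (intro compact_continuous_image compact_orth_group continuous_on_compose2[OF f]
        continuous_intros) auto
  then obtain B where "\<And>Q::'n sqmat. Q \<in> orth_group \<Longrightarrow> norm (f (Q ** I_MN M ** transpose Q)) \<le> B"
    using compact_imp_bounded by (force simp: bounded_iff)
  then have "AE A in haar_A M. norm (f A) \<le> B"
    by (intro AE_haar_A) auto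
  then show ?thesis by (rule integrable_const_bound) measurable
qed

lemma transpose_I_MN: "transpose (I_MN M) = I_MN M"
  by (auto simp: I_MN_def transpose_def vec_eq_iff)

lemma I_MN_idem: "I_MN M ** I_MN M = I_MN M"
  by (auto simp: I_MN_def matrix_matrix_mult_def vec_eq_iff if_distrib[of "\<lambda>x. x * _"] sum.delta'
      intro!: sum.neutral cong: if_cong)

lemma bij_betw_card_less: "bij_betw (\<lambda>r::'n::{finite,linorder}. card {j. j < r}) UNIV {..<CARD('n)}"
proof -
  let ?h = "\<lambda>r::'n. card {j. j < r}"
  have "strict_mono ?h"
    by (intro strict_monoI psubset_card_mono) (auto intro: less_trans)
  then have inj: "inj ?h" by (rule strict_mono_imp_inj_on)
  have "?h r < CARD('n)" for r
    by (intro psubset_card_mono) auto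
  then have "range ?h = {..<CARD('n)}"
    using inj by (intro card_subset_eq) (auto simp: card_image)
  with inj show ?thesis by (simp add: bij_betw_def)
qed

lemma trace_I_MN:
  assumes "M \<le> CARD('n::{finite,linorder})"
  shows "trace (I_MN M :: 'n sqmat) = real M"
proof -
  have "trace (I_MN M :: 'n sqmat) = (\<Sum>r::'n\<in>UNIV. if card {j. j < r} < M then 1 else 0)"
    by (simp add: trace_def I_MN_def)
  also have "\<dots> = (\<Sum>l<CARD('n). if l < M then 1 else 0)"
    by (rule sum.reindex_bij_betw[OF bij_betw_card_less])
  also have "\<dots> = (\<Sum>l<M. 1)"
    using assms by (intro sum.mono_neutral_cong_right) auto
  finally show ?thesis by simp
qed

lemma AE_haar_A_transpose: "AE A in haar_A M. transpose A = A"
  by (rule AE_haar_A) (auto simp: matrix_transpose_mul transpose_I_MN matrix_mul_assoc)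

lemma AE_haar_A_idem: "AE A in haar_A M. A ** A = A"
proof (rule AE_haar_A)
  fix Q :: "'a sqmat" assume "Q \<in> orth_group"
  then have Q: "transpose Q ** Q = mat 1" by (simp add: orth_group_def orthogonal_matrix)
  have "(Q ** I_MN M ** transpose Q) ** (Q ** I_MN M ** transpose Q)
      = Q ** I_MN M ** (transpose Q ** Q) ** I_MN M ** transpose Q"
    by (simp only: matrix_mul_assoc)
  also have "\<dots> = Q ** (I_MN M ** I_MN M) ** transpose Q"
    by (simp only: Q matrix_mul_assoc matrix_mul_rid)
  finally show "(Q ** I_MN M ** transpose Q) ** (Q ** I_MN M ** transpose Q)
      = Q ** I_MN M ** transpose Q"
    by (simp add: I_MN_idem)
qed measurable

lemma AE_haar_A_trace:
  assumes "M \<le> CARD('n::{finite,linorder})"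
  shows "AE A in (haar_A M :: ('n sqmat) measure). trace A = real M"
proof (rule AE_haar_A)
  fix Q :: "'n sqmat" assume Q: "Q \<in> orth_group"
  have "trace (Q ** I_MN M ** transpose Q) = trace (transpose Q ** Q ** I_MN M)"
    by (simp add: trace_mul_sym[of "Q ** I_MN M"] matrix_mul_assoc)
  also have "\<dots> = trace (I_MN M :: 'n sqmat)"
    using Q by (simp add: orth_group_def orthogonal_matrix)
  finally show "trace (Q ** I_MN M ** transpose Q) = real M"
    by (simp add: trace_I_MN[OF assms])
next
  have "trace \<in> borel_measurable (borel :: ('n sqmat) measure)"
    unfolding trace_def by (intro borel_measurable_continuous_onI continuous_intros)
  then show "Measurable.pred borel (\<lambda>A::'n sqmat. trace A = real M)"
    by measurable
qed

section \<open>Moments\<close>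

definition prod_pairs :: "('a \<Rightarrow> 'a \<Rightarrow> real) \<Rightarrow> nat \<Rightarrow> (nat \<Rightarrow> 'a) \<Rightarrow> real" where
  "prod_pairs F k x = (\<Prod>j<k. F (x (2*j+1)) (x (2*j+2)))"

lemma prod_pairs_Suc [simp]:
  "prod_pairs F (Suc k) x = prod_pairs F k x * F (x (2*k+1)) (x (2*k+2))"
  by (simp add: prod_pairs_def)

lemma prod_pairs_cong:
  assumes "\<And>p. p \<in> {1..2*k} \<Longrightarrow> x p = y p"
  shows "prod_pairs F k x = prod_pairs F k y"
  unfolding prod_pairs_def by (intro prod.cong refl) (simp add: assms)

lemma prod_pairs_fun_upd_cases:
  assumes "p \<in> {1..2*k}"
  obtains (fst) c w where "\<And>y. prod_pairs F k (x(p := y)) = c * F y w"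
    | (snd) c w where "\<And>y. prod_pairs F k (x(p := y)) = c * F w y"
proof -
  obtain l where l: "l < k" "p = 2*l+1 \<or> p = 2*l+2"
  proof
    show "(p - 1) div 2 < k" "p = 2 * ((p - 1) div 2) + 1 \<or> p = 2 * ((p - 1) div 2) + 2"
      using assms by auto
  qed
  define c where "c = (\<Prod>j\<in>{..<k}-{l}. F (x (2*j+1)) (x (2*j+2)))"
  have split: "prod_pairs F k (x(p := y)) = c * F ((x(p := y)) (2*l+1)) ((x(p := y)) (2*l+2))" for y
  proof -
    have "prod_pairs F k (x(p := y)) = F ((x(p := y)) (2*l+1)) ((x(p := y)) (2*l+2))
        * (\<Prod>j\<in>{..<k}-{l}. F ((x(p := y)) (2*j+1)) ((x(p := y)) (2*j+2)))"
      unfolding prod_pairs_def using l(1) by (intro prod.remove) auto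
    also have "(\<Prod>j\<in>{..<k}-{l}. F ((x(p := y)) (2*j+1)) ((x(p := y)) (2*j+2))) = c"
      unfolding c_def using l(2) by (intro prod.cong refl) auto
    finally show ?thesis by (simp only: mult.commute)
  qed
  from l(2) show thesis
  proof
    assume "p = 2*l+1"
    then show thesis by (intro fst[of c "x (2*l+2)"]) (subst split, simp)
  next
    assume "p = 2*l+2"
    then show thesis by (intro snd[of c "x (2*l+1)"]) (subst split, simp)
  qed
qed

lemma linear_prod_pairs_fun_upd:
  fixes F :: "'a::real_vector \<Rightarrow> 'a \<Rightarrow> real"
  assumes F: "bilinear F" and p: "p \<in> {1..2*k}"
  shows "linear (\<lambda>y. prod_pairs F k (x(p := y)))"
proof -
  have scaled: "linear (\<lambda>y. c * F y w)" "linear (\<lambda>y. c * F w y)" for c w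
    using F linear_compose_scale_right[of "\<lambda>y. F y w" c] linear_compose_scale_right[of "F w" c]
    by (simp_all add: bilinear_def)
  show ?thesis
    using p by (cases rule: prod_pairs_fun_upd_cases[where F = F and x = x]) (simp_all only: scaled)
qed

abbreviation entry_prod :: "'n::finite sqmat \<Rightarrow> nat \<Rightarrow> (nat \<Rightarrow> 'n) \<Rightarrow> real" where
  "entry_prod A \<equiv> prod_pairs (\<lambda>a b. A $ a $ b)"

abbreviation form_prod :: "'n::finite sqmat \<Rightarrow> nat \<Rightarrow> (nat \<Rightarrow> 'n rvec) \<Rightarrow> real" where
  "form_prod A \<equiv> prod_pairs (\<lambda>x y. x \<bullet> (A *v y))"

definition moment :: "nat \<Rightarrow> nat \<Rightarrow> (nat \<Rightarrow> 'n::{finite,linorder}) \<Rightarrow> real" where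
  "moment M k i = (\<integral>A. entry_prod A k i \<partial>haar_A M)"

definition moment_form :: "nat \<Rightarrow> nat \<Rightarrow> (nat \<Rightarrow> 'n::{finite,linorder} rvec) \<Rightarrow> real" where
  "moment_form M k x = (\<integral>A. form_prod A k x \<partial>haar_A M)"

lemma moment_eq_moment_form: "moment M k i = moment_form M k (\<lambda>p. axis (i p) 1)"
  by (simp add: moment_def moment_form_def prod_pairs_def matrix_vector_mult_basis inner_axis'
      column_def)

lemma moment_form_cong:
  assumes "\<And>p. p \<in> {1..2*k} \<Longrightarrow> x p = y p"
  shows "moment_form M k x = moment_form M k y"
  unfolding moment_form_def by (intro Bochner_Integration.integral_cong refl prod_pairs_cong assms)

lemma moment_cong:
  assumes "\<And>p. p \<in> {1..2*k} \<Longrightarrow> i p = j p"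
  shows "moment M k i = moment M k j"
  unfolding moment_eq_moment_form by (rule moment_form_cong) (simp add: assms)

lemma continuous_on_entry_prod:
  "continuous_on S (\<lambda>A. entry_prod A k i)"
  unfolding prod_pairs_def by (intro continuous_intros)

lemma continuous_on_form_prod:
  fixes x :: "nat \<Rightarrow> 'n::finite rvec"
  shows "continuous_on S (\<lambda>A. form_prod A k x)"
  unfolding prod_pairs_def matrix_vector_mult_def by (intro continuous_intros)

lemma sum_moment_eqI:
  fixes i :: "nat \<Rightarrow> 'n::{finite,linorder}"
  assumes "AE A in haar_A M. (\<Sum>v\<in>S. entry_prod A k (j v))
      = c * entry_prod A l i"
  shows "(\<Sum>v\<in>S. moment M k (j v)) = c * moment M l i"
proof -
  have "(\<Sum>v\<in>S. moment M k (j v)) = (\<integral>A. (\<Sum>v\<in>S. entry_prod A k (j v)) \<partial>haar_A M)"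
    unfolding moment_def
    by (intro Bochner_Integration.integral_sum[symmetric] integrable_haar_A
        continuous_on_entry_prod)
  also have "\<dots> = (\<integral>A. c * entry_prod A l i \<partial>haar_A M)"
    using assms
    by (intro integral_cong_AE borel_measurable_integrable integrable_haar_A
        continuous_intros continuous_on_entry_prod)
  finally show ?thesis by (simp add: moment_def)
qed

lemma moment_form_orthogonal_transformation:
  fixes f :: "'n::{finite,linorder} rvec \<Rightarrow> 'n rvec"
  assumes f: "orthogonal_transformation f"
  shows "moment_form M k (\<lambda>p. f (x p)) = moment_form M k x"
proof -
  define U where "U = transpose (matrix f)"
  have U: "U \<in> orth_group"
    using f by (simp add: U_def orth_group_def orthogonal_transformation_matrix)
  have f_eq: "f v = transpose U *v v" for v
    using f by (simp add: U_def matrix_works orthogonal_transformation_linear)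
  have "f v \<bullet> w = v \<bullet> (U *v w)" for v w
    using dot_lmul_matrix[of v U w] by (simp add: f_eq)
  with f_eq have "form_prod A k (\<lambda>p. f (x p))
      = form_prod (U ** A ** transpose U) k x" for A
    by (simp add: prod_pairs_def matrix_vector_mul_assoc matrix_mul_assoc
        del: transpose_matrix_vector)
  then have "moment_form M k (\<lambda>p. f (x p))
      = (\<integral>A. form_prod (U ** A ** transpose U) k x \<partial>haar_A M)"
    by (simp add: moment_form_def)
  also have "\<dots> = (\<integral>A. form_prod A k x
      \<partial>distr (haar_A M) borel (\<lambda>A. U ** A ** transpose U))"
    using borel_measurable_continuous_onI[OF continuous_on_form_prod]
    by (intro integral_distr[symmetric]) measurable
  finally show ?thesis
    by (simp add: distr_haar_A_conj[OF U] moment_form_def)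
qed

lemma linear_lebesgue_integral:
  fixes F :: "'v::real_vector \<Rightarrow> 'a \<Rightarrow> real"
  assumes "\<And>a. linear (\<lambda>y. F y a)" "\<And>y. integrable M (F y)"
  shows "linear (\<lambda>y. \<integral>a. F y a \<partial>M)"
  by (rule linearI) (simp_all add: assms(2) linear_add[OF assms(1)] linear_scale[OF assms(1)])

lemma linear_moment_form_fun_upd:
  fixes x :: "nat \<Rightarrow> 'n::{finite,linorder} rvec"
  assumes "p \<in> {1..2*k}"
  shows "linear (\<lambda>y. moment_form M k (x(p := y)))"
  unfolding moment_form_def
proof (rule linear_lebesgue_integral)
  fix A :: "'n sqmat"
  have "bilinear (\<lambda>x y. x \<bullet> (A *v y))"
    by (auto simp: bilinear_def linear_iff inner_add_left inner_add_right
        matrix_vector_right_distrib matrix_vector_mult_scaleR)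
  then show "linear (\<lambda>y. form_prod A k (x(p := y)))"
    using assms by (rule linear_prod_pairs_fun_upd)
qed (intro integrable_haar_A continuous_on_form_prod)

lemma moment_comp_bij:
  assumes bij: "bij (\<pi> :: 'n \<Rightarrow> 'n::{finite,linorder})"
  shows "moment M k (\<lambda>p. \<pi> (i p)) = moment M k i"
proof -
  define f :: "'n rvec \<Rightarrow> 'n rvec" where "f x = (\<chi> a. x $ inv \<pi> a)" for x
  have "linear f" by (rule linearI) (auto simp: f_def vec_eq_iff)
  moreover have "f x \<bullet> f y = x \<bullet> y" for x y
    unfolding f_def inner_vec_def
    using sum.reindex_bij_betw[OF bij_imp_bij_inv[OF bij], of "\<lambda>a. x $ a \<bullet> y $ a"] by simp
  ultimately have f: "orthogonal_transformation f" by (simp add: orthogonal_transformation_def)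
  have "f (axis a 1) = axis (\<pi> a) 1" for a
    using bij_inv_eq_iff[OF bij] by (simp add: f_def axis_def vec_eq_iff) metis
  then show ?thesis
    using moment_form_orthogonal_transformation[OF f, of M k "\<lambda>p. axis (i p) 1"]
    by (simp add: moment_eq_moment_form)
qed

lemma bij_of_same_kernel:
  fixes i j :: "'a \<Rightarrow> 'n::finite"
  assumes kernel: "\<And>a b. a \<in> D \<Longrightarrow> b \<in> D \<Longrightarrow> i a = i b \<longleftrightarrow> j a = j b"
  obtains \<pi> where "bij \<pi>" "\<And>a. a \<in> D \<Longrightarrow> \<pi> (i a) = j a"
proof -
  define h where "h v = j (inv_into D i v)" for v
  have h: "h (i a) = j a" if "a \<in> D" for a
    using kernel[of "inv_into D i (i a)" a] that by (simp add: h_def inv_into_into f_inv_into_f)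
  have "inj_on h (i ` D)"
    by (rule inj_onI) (auto simp: h kernel)
  moreover have "h ` i ` D = j ` D"
    by (auto simp: h image_image)
  ultimately have h_bij: "bij_betw h (i ` D) (j ` D)"
    by (simp add: bij_betw_def)
  then have "card (- (i ` D)) = card (- (j ` D))"
    by (simp add: bij_betw_same_card Compl_eq_Diff_UNIV card_Diff_subset)
  then obtain g where "bij_betw g (- (i ` D)) (- (j ` D))"
    using finite_same_card_bij[of "- (i ` D)" "- (j ` D)"] by auto
  with h_bij have "bij_betw (\<lambda>v. if v \<in> i ` D then h v else g v)
      (i ` D \<union> - (i ` D)) (j ` D \<union> - (j ` D))"
    by (intro bij_betw_disjoint_Un) auto
  then show thesis
    by (intro that) (auto simp: h)
qed

lemma moment_same_kernel:
  fixes i j :: "nat \<Rightarrow> 'n::{finite,linorder}"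
  assumes "\<And>a b. a \<in> {1..2*k} \<Longrightarrow> b \<in> {1..2*k} \<Longrightarrow> i a = i b \<longleftrightarrow> j a = j b"
  shows "moment M k i = moment M k j"
proof -
  obtain \<pi> where "bij \<pi>" "\<And>a. a \<in> {1..2*k} \<Longrightarrow> \<pi> (i a) = j a"
    using bij_of_same_kernel[of "{1..2*k}" i j] assms by blast
  then show ?thesis
    using moment_comp_bij[of \<pi> M k i] moment_cong[of k "\<lambda>a. \<pi> (i a)" j M] by simp
qed

section \<open>The infinitesimal form of rotation invariance\<close>

definition plane_rotation :: "'a::real_inner \<Rightarrow> 'a \<Rightarrow> real \<Rightarrow> 'a \<Rightarrow> 'a" where
  "plane_rotation u v \<theta> x = x + (u \<bullet> x) *\<^sub>R ((cos \<theta> - 1) *\<^sub>R u + sin \<theta> *\<^sub>R v)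
     + (v \<bullet> x) *\<^sub>R ((cos \<theta> - 1) *\<^sub>R v - sin \<theta> *\<^sub>R u)"

lemma orthogonal_transformation_plane_rotation:
  assumes "u \<bullet> u = 1" "v \<bullet> v = 1" "u \<bullet> v = 0"
  shows "orthogonal_transformation (plane_rotation u v \<theta>)"
  unfolding orthogonal_transformation_def
proof (intro conjI allI)
  show "linear (plane_rotation u v \<theta>)"
    by (rule linearI) (simp_all add: plane_rotation_def inner_add_right algebra_simps)
  fix x y
  define c s where "c = cos \<theta>" and "s = sin \<theta>"
  have "plane_rotation u v \<theta> x \<bullet> plane_rotation u v \<theta> y
      = x \<bullet> y + ((u \<bullet> x) * (u \<bullet> y) + (v \<bullet> x) * (v \<bullet> y)) * (s\<^sup>2 + c\<^sup>2 - 1)"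
    using assms unfolding plane_rotation_def c_def[symmetric] s_def[symmetric]
    by (simp add: inner_add inner_diff inner_commute[of x] inner_commute[of v u])
      (simp add: algebra_simps power2_eq_square)
  then show "plane_rotation u v \<theta> x \<bullet> plane_rotation u v \<theta> y = x \<bullet> y"
    by (simp add: c_def s_def)
qed

lemma orthogonal_transformation_plane_rotation_axis:
  "u \<noteq> v \<Longrightarrow> orthogonal_transformation (plane_rotation (axis u 1 :: real^'n) (axis v 1) \<theta>)"
  by (intro orthogonal_transformation_plane_rotation) (auto simp: inner_axis_axis)

lemma plane_rotation_axis:
  assumes "u \<noteq> v"
  shows "plane_rotation (axis u 1) (axis v 1) \<theta> (axis a 1 :: real^'n)
    = (if a = u then cos \<theta> *\<^sub>R axis u 1 + sin \<theta> *\<^sub>R axis v 1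
       else if a = v then cos \<theta> *\<^sub>R axis v 1 - sin \<theta> *\<^sub>R axis u 1 else axis a 1)"
  using assms by (auto simp: plane_rotation_def inner_axis_axis algebra_simps)

lemma has_real_derivative_multilinear_rotation:
  fixes T :: "('i \<Rightarrow> 'v::real_vector) \<Rightarrow> real"
  assumes "finite S" "\<And>x t. t \<in> S \<Longrightarrow> linear (\<lambda>z. T (x(t := z)))"
  shows "((\<lambda>\<theta>. T (\<lambda>t. if t \<in> S then cos \<theta> *\<^sub>R x t + sin \<theta> *\<^sub>R y t else x t))
    has_real_derivative (\<Sum>t\<in>S. T (x(t := y t)))) (at 0)"
  using assms
proof (induction S arbitrary: x)
  case (insert s S)
  let ?R = "\<lambda>x \<theta> t. if t \<in> S then cos \<theta> *\<^sub>R x t + sin \<theta> *\<^sub>R y t else x t"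
  let ?x = "x(s := y s)"
  have IH: "((\<lambda>\<theta>. T (?R x \<theta>)) has_real_derivative (\<Sum>t\<in>S. T (x(t := y t)))) (at 0)" for x
    by (rule insert.IH) (rule insert.prems, simp)
  have R_0: "?R x 0 = x" for x
    by (simp add: fun_eq_iff)
  have "((\<lambda>\<theta>. cos \<theta> * T (?R x \<theta>) + sin \<theta> * T (?R ?x \<theta>))
      has_real_derivative (\<Sum>t\<in>insert s S. T (x(t := y t)))) (at 0)"
    by (rule DERIV_cong[OF DERIV_add[OF DERIV_mult'[OF DERIV_cos IH] DERIV_mult'[OF DERIV_sin IH]]])
      (simp only: R_0 sum.insert[OF insert.hyps], simp add: fun_upd_def)
  moreover have "T (\<lambda>t. if t \<in> insert s S then cos \<theta> *\<^sub>R x t + sin \<theta> *\<^sub>R y t else x t)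
      = cos \<theta> * T (?R x \<theta>) + sin \<theta> * T (?R ?x \<theta>)" for \<theta>
  proof -
    have linear: "linear (\<lambda>z. T ((?R x \<theta>)(s := z)))"
      by (rule insert.prems) simp
    have "(\<lambda>t. if t \<in> insert s S then cos \<theta> *\<^sub>R x t + sin \<theta> *\<^sub>R y t else x t)
        = (?R x \<theta>)(s := cos \<theta> *\<^sub>R x s + sin \<theta> *\<^sub>R y s)"
      by (auto simp: fun_eq_iff)
    moreover have "(?R x \<theta>)(s := x s) = ?R x \<theta>" "(?R x \<theta>)(s := y s) = ?R ?x \<theta>"
      using insert.hyps by (auto simp: fun_eq_iff)
    ultimately show ?thesis
      using linear_add[OF linear] linear_cmul[OF linear] by (simp only: real_scaleR_def)
  qed
  ultimately show ?case by (simp only:)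
qed simp

lemma moment_rotation_derivative:
  fixes i :: "nat \<Rightarrow> 'n::{finite,linorder}"
  assumes uv: "u \<noteq> v"
  shows "(\<Sum>t | t \<in> {1..2*k} \<and> i t = u. moment M k (i(t := v)))
    = (\<Sum>t | t \<in> {1..2*k} \<and> i t = v. moment M k (i(t := u)))"
proof -
  let ?e = "\<lambda>a :: 'n. axis a 1 :: 'n rvec"
  let ?U = "{t. t \<in> {1..2*k} \<and> i t = u}" and ?V = "{t. t \<in> {1..2*k} \<and> i t = v}"
  define x where "x t = ?e (i t)" for t
  define y where "y t = (if i t = u then ?e v else - ?e u)" for t
  let ?R = "\<lambda>\<theta> t. if t \<in> ?U \<union> ?V then cos \<theta> *\<^sub>R x t + sin \<theta> *\<^sub>R y t else x t"
  have linear: "linear (\<lambda>z. moment_form M k (w(t := z)))" if "t \<in> ?U \<union> ?V" for w t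
    using that by (intro linear_moment_form_fun_upd) auto
  have upd: "moment_form M k (x(t := ?e a)) = moment M k (i(t := a))" for t a
    by (auto simp: moment_eq_moment_form x_def fun_upd_def intro: moment_form_cong)
  have "moment_form M k (?R \<theta>) = moment_form M k x" for \<theta>
  proof -
    have "moment_form M k (?R \<theta>) = moment_form M k (\<lambda>t. plane_rotation (?e u) (?e v) \<theta> (x t))"
      using uv by (intro moment_form_cong) (auto simp: x_def y_def plane_rotation_axis)
    also have "\<dots> = moment_form M k x"
      using uv
      by (intro moment_form_orthogonal_transformation orthogonal_transformation_plane_rotation_axis)
    finally show ?thesis .
  qed
  then have "((\<lambda>\<theta>. moment_form M k (?R \<theta>)) has_real_derivative 0) (at 0)"
    by simp
  moreover have "((\<lambda>\<theta>. moment_form M k (?R \<theta>)) has_real_derivative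
      (\<Sum>t\<in>?U \<union> ?V. moment_form M k (x(t := y t)))) (at 0)"
    by (rule has_real_derivative_multilinear_rotation) (simp, rule linear)
  ultimately have "0 = (\<Sum>t\<in>?U \<union> ?V. moment_form M k (x(t := y t)))"
    by (rule DERIV_unique)
  also have "\<dots> = (\<Sum>t\<in>?U. moment_form M k (x(t := y t))) + (\<Sum>t\<in>?V. moment_form M k (x(t := y t)))"
    using uv by (intro sum.union_disjoint) auto
  also have "(\<Sum>t\<in>?U. moment_form M k (x(t := y t))) = (\<Sum>t\<in>?U. moment M k (i(t := v)))"
    by (intro sum.cong refl) (simp add: y_def upd)
  also have "(\<Sum>t\<in>?V. moment_form M k (x(t := y t))) = - (\<Sum>t\<in>?V. moment M k (i(t := u)))"
    unfolding sum_negf[symmetric] using uv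
    by (intro sum.cong refl) (simp add: y_def upd[symmetric] linear_neg[OF linear])
  finally show ?thesis by linarith
qed

section \<open>Summing over a common value of two indices\<close>

lemma sum_moment_trace:
  fixes i :: "nat \<Rightarrow> 'n::{finite,linorder}"
  assumes M: "M \<le> CARD('n)"
  shows "(\<Sum>v\<in>UNIV. moment M (Suc n) (i(2*n+1 := v, 2*n+2 := v))) = real M * moment M n i"
proof (rule sum_moment_eqI)
  show "AE A in haar_A M. (\<Sum>v\<in>UNIV. entry_prod A (Suc n) (i(2*n+1 := v, 2*n+2 := v)))
      = real M * entry_prod A n i"
    using AE_haar_A_trace[OF M]
  proof eventually_elim
    case (elim A)
    have "entry_prod A n (i(2*n+1 := v, 2*n+2 := v)) = entry_prod A n i" for v
      by (rule prod_pairs_cong) auto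
    then show ?case
      by (simp add: sum_distrib_left[symmetric] elim[unfolded trace_def])
  qed
qed

lemma transpose_eq_self_nth:
  assumes "transpose A = A"
  shows "A $ a $ b = A $ b $ a"
  using arg_cong[OF assms, of "\<lambda>B. B $ b $ a"] by (simp add: transpose_def)

lemma sum_entry_prod_idem:
  fixes A :: "'n::finite sqmat"
  assumes A: "transpose A = A" "A ** A = A" and p: "p \<in> {1..2*k}"
  shows "(\<Sum>v\<in>UNIV. entry_prod A k (i(p := v)) * A $ v $ z)
    = entry_prod A k (i(p := z))"
proof -
  have square: "(\<Sum>v\<in>UNIV. A $ a $ v * A $ v $ b) = A $ a $ b" for a b
    using arg_cong[OF A(2), of "\<lambda>B. B $ a $ b"] by (simp add: matrix_matrix_mult_def)
  have square_sym: "(\<Sum>v\<in>UNIV. A $ v $ a * A $ v $ b) = A $ b $ a" for a b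
    using square[of a b] by (simp add: transpose_eq_self_nth[OF A(1), of a])
  from p show ?thesis
    by (cases rule: prod_pairs_fun_upd_cases[where F = "\<lambda>a b. A $ a $ b" and x = i])
      (simp_all only: mult.assoc sum_distrib_left[symmetric] square square_sym)
qed

lemma sum_moment_idem:
  fixes i :: "nat \<Rightarrow> 'n::{finite,linorder}"
  assumes b: "b \<in> {1..2*n}"
  shows "(\<Sum>v\<in>UNIV. moment M (Suc n) (i(2*n+1 := v, b := v))) = moment M n (i(b := i (2*n+2)))"
proof -
  have "(\<Sum>v\<in>UNIV. moment M (Suc n) (i(2*n+1 := v, b := v))) = 1 * moment M n (i(b := i (2*n+2)))"
  proof (rule sum_moment_eqI)
    show "AE A in haar_A M. (\<Sum>v\<in>UNIV. entry_prod A (Suc n) (i(2*n+1 := v, b := v)))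
        = 1 * entry_prod A n (i(b := i (2*n+2)))"
      using AE_haar_A_transpose AE_haar_A_idem
    proof eventually_elim
      case (elim A)
      have "entry_prod A (Suc n) (i(2*n+1 := v, b := v))
          = entry_prod A n (i(b := v)) * A $ v $ i (2*n+2)" for v
      proof -
        have "entry_prod A n (i(2*n+1 := v, b := v)) = entry_prod A n (i(b := v))"
          by (rule prod_pairs_cong) auto
        then show ?thesis using b by simp
      qed
      then show ?case
        by (simp only: sum_entry_prod_idem[OF elim b] mult_1)
    qed
  qed
  then show ?thesis by simp
qed

lemma moment_swap_last:
  "moment M (Suc n) (\<lambda>t. i (transp_ab (2*n+2) (2*n+1) t)) = moment M (Suc n) i"
  unfolding moment_def
proof (rule integral_cong_AE)
  let ?i = "\<lambda>t. i (transp_ab (2*n+2) (2*n+1) t)"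
  show "AE A in haar_A M. entry_prod A (Suc n) ?i = entry_prod A (Suc n) i"
    using AE_haar_A_transpose
  proof eventually_elim
    case (elim A)
    have "entry_prod A n ?i = entry_prod A n i"
      by (rule prod_pairs_cong) (auto simp: transp_ab_def)
    moreover have "A $ i (2*n+2) $ i (2*n+1) = A $ i (2*n+1) $ i (2*n+2)"
      using elim by (rule transpose_eq_self_nth)
    ultimately show ?case by (simp add: transp_ab_def)
  qed
qed (intro borel_measurable_integrable integrable_haar_A continuous_on_entry_prod)+

lemma moment_merge_pair:
  fixes i :: "nat \<Rightarrow> 'n::{finite,linorder}"
  assumes fibre: "{t \<in> {1..2*k}. i t = i p} = {p, b}" and pb: "p \<noteq> b"
  shows "moment M k (i(p := v, b := v)) = moment M k i
    + (\<Sum>x | x \<in> {1..2*k} - {p, b} \<and> i x = v. moment M k (\<lambda>t. i (transp_ab x p t)))"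
proof -
  let ?X = "{x. x \<in> {1..2*k} - {p, b} \<and> i x = v}"
  have fibre_mem: "p \<in> {1..2*k}" "b \<in> {1..2*k}" "i b = i p" using fibre by blast+
  show ?thesis
  proof (cases "v = i p")
    case True
    then have "i(p := v, b := v) = i"
      using fibre_mem(3) by (auto simp: fun_eq_iff)
    moreover have "?X = {}"
      using fibre True by blast
    ultimately show ?thesis by (simp only: sum.empty add_0_right)
  next
    case False
    let ?j = "i(p := v)"
    have fibre_v: "{t. t \<in> {1..2*k} \<and> ?j t = v} = insert p ?X"
      using fibre_mem False by auto
    have fibre_ip: "{t. t \<in> {1..2*k} \<and> ?j t = i p} = {b}"
      using fibre fibre_mem pb False by auto
    have "moment M k (i(p := v, b := v))
        = (\<Sum>t | t \<in> {1..2*k} \<and> ?j t = i p. moment M k (?j(t := v)))"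
      by (simp only: fibre_ip) simp
    also have "\<dots> = (\<Sum>t\<in>insert p ?X. moment M k (?j(t := i p)))"
      unfolding fibre_v[symmetric] using False by (intro moment_rotation_derivative) simp
    also have "\<dots> = moment M k i + (\<Sum>x\<in>?X. moment M k (?j(x := i p)))"
      by (subst sum.insert) auto
    also have "(\<Sum>x\<in>?X. moment M k (?j(x := i p)))
        = (\<Sum>x\<in>?X. moment M k (\<lambda>t. i (transp_ab x p t)))"
      by (intro sum.cong refl arg_cong[where f = "moment M k"])
        (auto simp: transp_ab_def fun_eq_iff)
    finally show ?thesis .
  qed
qed

lemma sum_moment_merge_pair:
  fixes i :: "nat \<Rightarrow> 'n::{finite,linorder}"
  assumes "{t \<in> {1..2*k}. i t = i p} = {p, b}" "p \<noteq> b"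
  shows "(\<Sum>v\<in>UNIV. moment M k (i(p := v, b := v))) = real CARD('n) * moment M k i
    + (\<Sum>x\<in>{1..2*k} - {p, b}. moment M k (\<lambda>t. i (transp_ab x p t)))"
proof -
  have "(\<Sum>v\<in>UNIV. \<Sum>x | x \<in> {1..2*k} - {p, b} \<and> i x = v. moment M k (\<lambda>t. i (transp_ab x p t)))
      = (\<Sum>x\<in>{1..2*k} - {p, b}. moment M k (\<lambda>t. i (transp_ab x p t)))"
    by (rule sum.group) auto
  then show ?thesis
    by (simp only: moment_merge_pair[OF assms] sum.distrib sum_constant)
qed

text \<open>If \<open>b \<noteq> 2n+2\<close>, the transposition at \<open>2n+2\<close> takes the place of the missing one at \<open>b\<close>: both
  leave the moment unchanged.\<close>

lemma sum_moment_merge_pair_last: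
  fixes i :: "nat \<Rightarrow> 'n::{finite,linorder}"
  assumes fibre: "{t \<in> {1..2*n+2}. i t = i (2*n+1)} = {2*n+1, b}" and b: "b \<noteq> 2*n+1"
  shows "(\<Sum>v\<in>UNIV. moment M (Suc n) (i(2*n+1 := v, b := v))) = real CARD('n) * moment M (Suc n) i
    + (\<Sum>x=1..2*n. moment M (Suc n) (\<lambda>t. i (transp_ab x (2*n+1) t)))"
proof -
  let ?W = "\<lambda>x. moment M (Suc n) (\<lambda>t. i (transp_ab x (2*n+1) t))"
  have b_le: "b \<in> {1..2*n+2}" and ib: "i b = i (2*n+1)" using fibre by auto
  have "sum ?W ({1..2 * Suc n} - {2*n+1, b}) = sum ?W {1..2*n}"
  proof (cases "b = 2*n+2")
    case True
    then have "{1..2 * Suc n} - {2*n+1, b} = {1..2*n}" by auto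
    then show ?thesis by simp
  next
    case False
    then have b_mem_n: "b \<in> {1..2*n}" using b b_le by auto
    have "(\<lambda>t. i (transp_ab b (2*n+1) t)) = i"
      using ib by (auto simp: transp_ab_def fun_eq_iff)
    then have W_b: "?W (2*n+2) = ?W b" by (simp only: moment_swap_last)
    have "{1..2 * Suc n} - {2*n+1, b} = insert (2*n+2) ({1..2*n} - {b})"
      using False b_mem_n by auto
    then have "sum ?W ({1..2 * Suc n} - {2*n+1, b}) = ?W b + sum ?W ({1..2*n} - {b})"
      by (simp add: W_b[simplified])
    also have "\<dots> = sum ?W {1..2*n}"
      using b_mem_n by (intro sum.remove[symmetric]) auto
    finally show ?thesis .
  qed
  then show ?thesis
    using sum_moment_merge_pair[of "Suc n" i "2*n+1" b M] fibre b by simp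
qed

section \<open>Pair partitions and the recursion\<close>

lemma transp_ab_involution [simp]: "transp_ab a b (transp_ab a b x) = x"
  by (simp add: transp_ab_def)

lemma transp_ab_mem:
  "a \<in> S \<Longrightarrow> b \<in> S \<Longrightarrow> x \<in> S \<Longrightarrow> transp_ab a b x \<in> S"
  by (simp add: transp_ab_def)

lemma pair_in_perm_act_transp_ab:
  "{x, y} \<in> perm_act (transp_ab a b) m \<longleftrightarrow> {transp_ab a b x, transp_ab a b y} \<in> m"
proof
  assume "{x, y} \<in> perm_act (transp_ab a b) m"
  then obtain B where B: "B \<in> m" "{x, y} = transp_ab a b ` B" by (auto simp: perm_act_def)
  have "transp_ab a b ` {x, y} = B" unfolding B(2) by (simp add: image_image)
  then show "{transp_ab a b x, transp_ab a b y} \<in> m" using B(1) by simp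
next
  assume "{transp_ab a b x, transp_ab a b y} \<in> m"
  then have "transp_ab a b ` {transp_ab a b x, transp_ab a b y} \<in> perm_act (transp_ab a b) m"
    unfolding perm_act_def by (rule imageI)
  then show "{x, y} \<in> perm_act (transp_ab a b) m" by simp
qed

lemma strongly_admissibleD:
  assumes "strongly_admissible k m i" "a \<in> {1..2*k}" "b \<in> {1..2*k}" "a \<noteq> b"
  shows "{a, b} \<in> m \<longleftrightarrow> i a = i b"
  using assms unfolding strongly_admissible_def by blast

lemma strongly_admissible_perm_act_transp_ab:
  assumes i: "strongly_admissible k m i" and ab: "a \<in> {1..2*k}" "b \<in> {1..2*k}"
  shows "strongly_admissible k (perm_act (transp_ab a b) m) (\<lambda>x. i (transp_ab a b x))"
  unfolding strongly_admissible_def pair_in_perm_act_transp_ab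
proof (intro ballI impI)
  fix x y assume xy: "x \<in> {1..2*k}" "y \<in> {1..2*k}" "x \<noteq> y"
  then have "transp_ab a b x \<noteq> transp_ab a b y" by (metis transp_ab_involution)
  then show "{transp_ab a b x, transp_ab a b y} \<in> m \<longleftrightarrow> i (transp_ab a b x) = i (transp_ab a b y)"
    by (rule strongly_admissibleD[OF i transp_ab_mem[OF ab xy(1)] transp_ab_mem[OF ab xy(2)]])
qed

lemma strongly_admissible_down:
  assumes i: "strongly_admissible (Suc n) m i"
  shows "strongly_admissible n (down (Suc n) m) i"
  unfolding strongly_admissible_def
proof (intro ballI impI)
  fix a b assume ab: "a \<in> {1..2*n}" "b \<in> {1..2*n}" "a \<noteq> b"
  then have "{a, b} \<in> down (Suc n) m \<longleftrightarrow> {a, b} \<in> m"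
    by (auto simp: down_def doubleton_eq_iff)
  also have "\<dots> \<longleftrightarrow> i a = i b"
    using ab by (intro strongly_admissibleD[OF i]) auto
  finally show "{a, b} \<in> down (Suc n) m \<longleftrightarrow> i a = i b" .
qed

lemma pair_partitionsD:
  assumes "m \<in> pair_partitions k"
  shows "B \<in> m \<Longrightarrow> card B = 2" "\<Union>m = {1..2*k}"
    and "B \<in> m \<Longrightarrow> C \<in> m \<Longrightarrow> a \<in> B \<Longrightarrow> a \<in> C \<Longrightarrow> B = C"
proof -
  show "B \<in> m \<Longrightarrow> card B = 2" "\<Union>m = {1..2*k}"
    using assms by (simp_all add: pair_partitions_def)
  have "B \<in> m \<Longrightarrow> C \<in> m \<Longrightarrow> B \<noteq> C \<Longrightarrow> B \<inter> C = {}"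
    using assms by (simp add: pair_partitions_def)
  then show "B \<in> m \<Longrightarrow> C \<in> m \<Longrightarrow> a \<in> B \<Longrightarrow> a \<in> C \<Longrightarrow> B = C"
    by blast
qed

lemma pair_partitions_pairD:
  assumes "m \<in> pair_partitions k" "{a, b} \<in> m"
  shows "a \<in> {1..2*k}" "b \<in> {1..2*k}" "a \<noteq> b"
  using pair_partitionsD(1)[OF assms] pair_partitionsD(2)[OF assms(1)] assms(2) by auto

lemma pair_partitions_partner_unique:
  assumes "m \<in> pair_partitions k" "{a, b} \<in> m" "{a, c} \<in> m"
  shows "b = c"
  using pair_partitionsD(3)[OF assms, of a] by (auto simp: doubleton_eq_iff)

lemma pair_partitions_partner_exists:
  assumes m: "m \<in> pair_partitions k" and a: "a \<in> {1..2*k}"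
  obtains b where "{a, b} \<in> m"
proof -
  obtain B where B: "B \<in> m" "a \<in> B"
    using a pair_partitionsD(2)[OF m] by blast
  then obtain x y where "B = {x, y}"
    using pair_partitionsD(1)[OF m B(1)] by (auto simp: card_2_iff)
  with B that show ?thesis by (auto simp: insert_commute)
qed

lemma card_pair_partition:
  assumes m: "m \<in> pair_partitions k"
  shows "finite m" "card m = k"
proof -
  show "finite m"
    using pair_partitionsD(2)[OF m] by (metis finite_UnionD finite_atLeastAtMost)
  have "pairwise disjnt m"
    using pair_partitionsD(3)[OF m] by (auto simp: pairwise_def disjnt_def)
  then have "card (\<Union>m) = sum card m"
    using pair_partitionsD(1)[OF m] by (intro card_Union_disjoint) (auto intro: card_ge_0_finite)
  then show "card m = k"
    by (simp add: pair_partitionsD(1,2)[OF m])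
qed

lemma strongly_admissible_exists:
  assumes m: "m \<in> pair_partitions k" and k: "k \<le> CARD('n::finite)"
  obtains i :: "nat \<Rightarrow> 'n::finite" where "strongly_admissible k m i"
proof -
  obtain f :: "nat set \<Rightarrow> 'n" where f: "inj_on f m"
    using card_le_inj[of m "UNIV :: 'n set"] card_pair_partition[OF m] k by auto
  have "\<exists>B. B \<in> m \<and> a \<in> B" if "a \<in> {1..2*k}" for a
    using that pair_partitionsD(2)[OF m] by blast
  then obtain block where block: "\<And>a. a \<in> {1..2*k} \<Longrightarrow> block a \<in> m \<and> a \<in> block a"
    by metis
  have "strongly_admissible k m (\<lambda>a. f (block a))"
    unfolding strongly_admissible_def
  proof (intro ballI impI)
    fix a b assume ab: "a \<in> {1..2*k}" "b \<in> {1..2*k}" "a \<noteq> b"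
    show "{a, b} \<in> m \<longleftrightarrow> f (block a) = f (block b)"
    proof
      assume "{a, b} \<in> m"
      then have "block a = {a, b}" "block b = {a, b}"
        using pair_partitionsD(3)[OF m, of "block a" "{a, b}" a]
          pair_partitionsD(3)[OF m, of "block b" "{a, b}" b] block ab by auto
      then show "f (block a) = f (block b)" by simp
    next
      assume "f (block a) = f (block b)"
      then have "block b = block a" using f block ab by (auto dest: inj_onD)
      then have "{a, b} \<subseteq> block a" using block[OF ab(1)] block[OF ab(2)] by auto
      moreover have "card (block a) = 2" using pair_partitionsD(1)[OF m] block ab by blast
      ultimately have "{a, b} = block a"
        using ab(3) by (intro card_subset_eq) (auto intro: card_ge_0_finite)
      then show "{a, b} \<in> m" using block ab by metis
    qed
  qed
  then show thesis by (rule that)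
qed

lemma strongly_admissible_eq_iff:
  assumes m: "m \<in> pair_partitions k" and i: "strongly_admissible k m i"
    and ab: "{a, b} \<in> m" and t: "t \<in> {1..2*k}"
  shows "i t = i a \<longleftrightarrow> t = a \<or> t = b"
  using strongly_admissibleD[OF i pair_partitions_pairD(1)[OF m ab] t]
    pair_partitions_partner_unique[OF m ab, of t] pair_partitions_pairD(3)[OF m ab] ab
  by (cases "t = a") auto

lemma WgA_eq_moment:
  fixes i :: "nat \<Rightarrow> 'n::{finite,linorder}"
  assumes i: "strongly_admissible k m i"
  shows "WgA TYPE('n) M k m = moment M k i"
proof (cases "k = 0")
  case True
  then show ?thesis
    using prob_space.prob_space[OF prob_space_haar_A]
    by (simp add: WgA_def moment_def prod_pairs_def)
next
  case False
  let ?i = "SOME i :: nat \<Rightarrow> 'n. strongly_admissible k m i"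
  have chosen: "strongly_admissible k m ?i"
    using i by (rule someI[where P = "strongly_admissible k m"])
  have "WgA TYPE('n) M k m = moment M k ?i"
    using False by (simp add: WgA_def moment_def prod_pairs_def Let_def)
  also have "\<dots> = moment M k i"
    using strongly_admissibleD[OF i] strongly_admissibleD[OF chosen]
    by (intro moment_same_kernel) metis
  finally show ?thesis .
qed

lemma sum_moment_merge_pair_WgA:
  fixes i :: "nat \<Rightarrow> 'n::{finite,linorder}"
  assumes m: "m \<in> pair_partitions (Suc n)" and i: "strongly_admissible (Suc n) m i"
    and b: "{2*n+1, b} \<in> m"
  shows "(\<Sum>v\<in>UNIV. moment M (Suc n) (i(2*n+1 := v, b := v)))
    = real CARD('n) * WgA TYPE('n) M (Suc n) m
      + (\<Sum>x=1..2*n. WgA TYPE('n) M (Suc n) (perm_act (transp_ab x (2*n+1)) m))"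
proof -
  have "(\<Sum>x=1..2*n. WgA TYPE('n) M (Suc n) (perm_act (transp_ab x (2*n+1)) m))
      = (\<Sum>x=1..2*n. moment M (Suc n) (\<lambda>t. i (transp_ab x (2*n+1) t)))"
    by (intro sum.cong refl WgA_eq_moment strongly_admissible_perm_act_transp_ab i) auto
  moreover have "(\<Sum>v\<in>UNIV. moment M (Suc n) (i(2*n+1 := v, b := v)))
      = real CARD('n) * moment M (Suc n) i
        + (\<Sum>x=1..2*n. moment M (Suc n) (\<lambda>t. i (transp_ab x (2*n+1) t)))"
    using pair_partitions_pairD[OF m b] strongly_admissible_eq_iff[OF m i b]
    by (intro sum_moment_merge_pair_last) auto
  ultimately show ?thesis
    by (simp only: WgA_eq_moment[OF i])
qed

proposition WgA_recursion_last_block: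
  fixes M n :: nat
  assumes "M \<le> CARD('n::{finite,linorder})" "Suc n \<le> CARD('n)"
    and m: "m \<in> pair_partitions (Suc n)" and block: "{2*n+1, 2*n+2} \<in> m"
  shows "real CARD('n) * WgA TYPE('n) M (Suc n) m
      + (\<Sum>x=1..2*n. WgA TYPE('n) M (Suc n) (perm_act (transp_ab x (2*n+1)) m))
    = real M * WgA TYPE('n) M n (down (Suc n) m)"
proof -
  obtain i :: "nat \<Rightarrow> 'n" where i: "strongly_admissible (Suc n) m i"
    using strongly_admissible_exists[OF m assms(2)] .
  have "real CARD('n) * WgA TYPE('n) M (Suc n) m
      + (\<Sum>x=1..2*n. WgA TYPE('n) M (Suc n) (perm_act (transp_ab x (2*n+1)) m))
      = (\<Sum>v\<in>UNIV. moment M (Suc n) (i(2*n+1 := v, 2*n+2 := v)))"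
    by (rule sum_moment_merge_pair_WgA[OF m i block, symmetric])
  also have "\<dots> = real M * moment M n i"
    by (rule sum_moment_trace[OF assms(1)])
  finally show ?thesis
    by (simp only: WgA_eq_moment[OF strongly_admissible_down[OF i]])
qed

lemma WgA_down_perm_act_transp_ab:
  fixes i :: "nat \<Rightarrow> 'n::{finite,linorder}"
  assumes m: "m \<in> pair_partitions (Suc n)" and i: "strongly_admissible (Suc n) m i"
    and a: "{a, 2*n+2} \<in> m" "a \<noteq> 2*n+1" and b: "{2*n+1, b} \<in> m"
  shows "WgA TYPE('n) M n (down (Suc n) (perm_act (transp_ab a (2*n+1)) m))
    = moment M n (i(b := i (2*n+2)))"
proof -
  let ?p = "2*n+1" and ?z = "2*n+2"
  have "strongly_admissible (Suc n) (perm_act (transp_ab a ?p) m) (\<lambda>t. i (transp_ab a ?p t))"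
    using pair_partitions_pairD[OF m a(1)]
    by (intro strongly_admissible_perm_act_transp_ab i) auto
  then have "WgA TYPE('n) M n (down (Suc n) (perm_act (transp_ab a ?p) m))
      = moment M n (\<lambda>t. i (transp_ab a ?p t))"
    by (intro WgA_eq_moment strongly_admissible_down)
  also have "\<dots> = moment M n (i(b := i ?z))"
  proof (rule moment_same_kernel)
    have i_z: "i ?z = i a" and i_p: "i ?p = i b"
      using strongly_admissibleD[OF i pair_partitions_pairD[OF m a(1)]] a(1)
        strongly_admissibleD[OF i pair_partitions_pairD[OF m b]] b by auto
    have "a \<noteq> b"
      using pair_partitions_partner_unique[OF m, of a ?z ?p] a b by (auto simp: insert_commute)
    have i_transp: "i (transp_ab a ?p t) = (if t = a then i b else i t)"
      and i_upd: "(i(b := i ?z)) t = (if t = b then i a else i t)"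
      and i_eq_iff: "i t = i a \<longleftrightarrow> t = a" "i t = i b \<longleftrightarrow> t = b" if "t \<in> {1..2*n}" for t
      using that i_z i_p strongly_admissible_eq_iff[OF m i a(1), of t]
        strongly_admissible_eq_iff[OF m i b, of t, unfolded i_p]
      by (auto simp: transp_ab_def)
    fix x y assume xy: "x \<in> {1..2*n}" "y \<in> {1..2*n}"
    then show "i (transp_ab a ?p x) = i (transp_ab a ?p y) \<longleftrightarrow> (i(b := i ?z)) x = (i(b := i ?z)) y"
      unfolding xy[THEN i_transp] xy[THEN i_upd]
      using \<open>a \<noteq> b\<close> xy[THEN i_eq_iff(1)] xy[THEN i_eq_iff(2)] by auto
  qed
  finally show ?thesis .
qed

proposition WgA_recursion_other_block:
  fixes M n :: nat
  assumes "Suc n \<le> CARD('n::{finite,linorder})"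
    and m: "m \<in> pair_partitions (Suc n)" and a: "{a, 2*n+2} \<in> m" "a \<noteq> 2*n+1"
  shows "real CARD('n) * WgA TYPE('n) M (Suc n) m
      + (\<Sum>x=1..2*n. WgA TYPE('n) M (Suc n) (perm_act (transp_ab x (2*n+1)) m))
    = WgA TYPE('n) M n (down (Suc n) (perm_act (transp_ab a (2*n+1)) m))"
proof -
  obtain i :: "nat \<Rightarrow> 'n" where i: "strongly_admissible (Suc n) m i"
    using strongly_admissible_exists[OF m assms(1)] .
  obtain b where b: "{2*n+1, b} \<in> m"
    using pair_partitions_partner_exists[OF m, of "2*n+1"] by auto
  have "b \<noteq> 2*n+2"
    using pair_partitions_partner_unique[OF m, of "2*n+2" a "2*n+1"] a b
    by (auto simp: insert_commute)
  then have b_le: "b \<in> {1..2*n}"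
    using pair_partitions_pairD[OF m b] by auto
  have "real CARD('n) * WgA TYPE('n) M (Suc n) m
      + (\<Sum>x=1..2*n. WgA TYPE('n) M (Suc n) (perm_act (transp_ab x (2*n+1)) m))
      = (\<Sum>v\<in>UNIV. moment M (Suc n) (i(2*n+1 := v, b := v)))"
    by (rule sum_moment_merge_pair_WgA[OF m i b, symmetric])
  also have "\<dots> = moment M n (i(b := i (2*n+2)))"
    by (rule sum_moment_idem[OF b_le])
  also have "\<dots> = WgA TYPE('n) M n (down (Suc n) (perm_act (transp_ab a (2*n+1)) m))"
    by (rule WgA_down_perm_act_transp_ab[OF m i a b, symmetric])
  finally show ?thesis .
qed

proposition WgA_recursion:
  fixes M n :: nat
  assumes "M \<le> CARD('n::{finite,linorder})" "Suc n \<le> CARD('n)" and m: "m \<in> pair_partitions (Suc n)"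
  shows "real CARD('n) * WgA TYPE('n) M (Suc n) m
      + (\<Sum>x=1..2*n. WgA TYPE('n) M (Suc n) (perm_act (transp_ab x (2*n+1)) m))
    = real M * (if {2*n+1, 2*n+2} \<in> m then WgA TYPE('n) M n (down (Suc n) m) else 0)
      + (\<Sum>x=1..2*n. if {x, 2*n+2} \<in> m
          then WgA TYPE('n) M n (down (Suc n) (perm_act (transp_ab x (2*n+1)) m)) else 0)"
proof -
  obtain a where a: "{a, 2*n+2} \<in> m"
    using pair_partitions_partner_exists[OF m, of "2*n+2"] by (auto simp: insert_commute)
  have partner: "{x, 2*n+2} \<in> m \<longleftrightarrow> x = a" for x
    using pair_partitions_partner_unique[OF m, of "2*n+2" x a] a by (auto simp: insert_commute)
  show ?thesis
  proof (cases "a = 2*n+1")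
    case True
    then show ?thesis
      unfolding partner using WgA_recursion_last_block[OF assms] a by simp
  next
    case False
    then have "a \<in> {1..2*n}" using pair_partitions_pairD[OF m a] by auto
    then show ?thesis
      unfolding partner using WgA_recursion_other_block[OF assms(2) m a False] False by simp
  qed
qed

theorem mainTheorem2:
  fixes M k :: nat and m :: "nat set set"
  defines "N \<equiv> CARD('n::{finite,linorder})"
  assumes "0 < M" and "M < N" and "1 \<le> k" and "k \<le> N"
    and "m \<in> pair_partitions k"
  shows "WgA TYPE('n) M k m =
      - (1 / real N) * (\<Sum>i=1..2*k-2. WgA TYPE('n) M k (perm_act (transp_ab i (2*k-1)) m))
      + (real M / real N) * (if {2*k-1, 2*k} \<in> m then WgA TYPE('n) M (k-1) (down k m) else 0)
      + (1 / real N) * (\<Sum>i=1..2*k-2. (if {i, 2*k} \<in> m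
            then WgA TYPE('n) M (k-1) (down k (perm_act (transp_ab i (2*k-1)) m)) else 0))"
proof -
  obtain n where "k = Suc n" using \<open>1 \<le> k\<close> by (cases k) auto
  then have k: "k = Suc n" "2*k-1 = 2*n+1" "2*k-2 = 2*n" "k - 1 = n" "2*k = 2*n+2" by auto
  have solve: "w = - (1 / real N) * s + (real M / real N) * x + (1 / real N) * y"
    if "real N * w + s = real M * x + y" for w s x y
    using that \<open>M < N\<close> by (simp add: field_simps)
  show ?thesis
    unfolding k(2-4) unfolding k(5) unfolding k(1) N_def
  proof (rule solve[unfolded N_def], rule WgA_recursion)
    show "M \<le> CARD('n)" "Suc n \<le> CARD('n)" "m \<in> pair_partitions (Suc n)"
      using assms k(1) by auto
  qed
qed

end
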